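(* Let $\tau$ be an infinite cardinal and $\lambda\leq\tau$ an infinite cardinal. Let $f:P\to K$ be a (surjective) homeomorphism between closed $\lambda$-negligible subsets $P$ and $K$ of $D^\tau$ such that $P=P^{(\lambda)}$ and $K=K^{(\lambda)}$. Then $f$ can be extended to a homeomorphism of $D^\tau$ onto itself.
   Context: $D=\{0,1\}$ is the two-point discrete space and $D^\tau$ is the product of $\tau$ copies of $D$ with the product topology. For a space $X$, a subset $P\subset X$ and an infinite cardinal $\mu$, the $\mu$-interior $P^{(\mu)}$ of $P$ in $X$ is the set of all $x\in P$ for which there exists a $G_\mu$-subset $G$ of $X$ (an intersection of at most $\mu$ open subsets of $X$) with $x\in G\subset P$. If $\mu$ is finite, $P^{(\mu)}$ is the ordinary interior of $P$ in $X$. For an infinite cardinal $\lambda$, the set $P$ is called $\lambda$-negligible in $X$ if $P^{(\mu)}=\varnothing$ for all cardinals $\mu<\lambda$. Here all these notions are taken with $X=D^\tau$. *)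

theory Defs
  imports "HOL-Analysis.Analysis"
begin

unbundle cardinal_syntax

text \<open>
  Cardinals are relations satisfying \<^const>\<open>Card_order\<close>, compared by \<open>\<le>o\<close> and \<open><o\<close>;
  \<^const>\<open>Cinfinite\<close> singles out the infinite ones. The field of the cardinal \<open>\<tau>\<close> serves as the
  index set with \<open>\<tau>\<close> elements.
\<close>

definition cantor_cube :: "'i rel \<Rightarrow> ('i \<Rightarrow> bool) topology" where
  "cantor_cube \<tau> = product_topology (\<lambda>_. discrete_topology (UNIV :: bool set)) (Field \<tau>)"

text \<open>The intersection with \<^term>\<open>topspace X\<close> only matters for the empty family.\<close>

definition G_subset :: "'a topology \<Rightarrow> 'k rel \<Rightarrow> 'a set \<Rightarrow> bool" where
  "G_subset X \<mu> G \<longleftrightarrow>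
     (\<exists>\<U>. (\<forall>U\<in>\<U>. openin X U) \<and> |\<U>| \<le>o \<mu> \<and> G = topspace X \<inter> \<Inter>\<U>)"

definition mu_interior :: "'a topology \<Rightarrow> 'k rel \<Rightarrow> 'a set \<Rightarrow> 'a set" where
  "mu_interior X \<mu> P =
     (if finite (Field \<mu>) then X interior_of P
      else {x \<in> P. \<exists>G. G_subset X \<mu> G \<and> x \<in> G \<and> G \<subseteq> P})"

text \<open>
  Every cardinal below \<open>\<kappa> :: 'k rel\<close> is the cardinality of a subset of \<^term>\<open>Field \<kappa>\<close>, so letting
  \<open>\<mu>\<close> range over the cardinals of type \<^typ>\<open>'k rel\<close> covers all cardinals \<open>\<mu> < \<kappa>\<close>.
\<close>

definition negligible_below :: "'a topology \<Rightarrow> 'k rel \<Rightarrow> 'a set \<Rightarrow> bool" where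
  "negligible_below X \<kappa> P \<longleftrightarrow>
     (\<forall>\<mu> :: 'k rel. Card_order \<mu> \<and> \<mu> <o \<kappa> \<longrightarrow> mu_interior X \<mu> P = {})"

end

theory Submission
  imports Defs "HOL-Library.Countable_Set_Type"
begin

text \<open>
  A set \<open>A\<close> of coordinates is admissible if \<open>f\<close> and its inverse \<open>g\<close> induce mutually inverse maps
  between the projections of \<open>P\<close> and \<open>K\<close> to \<open>A\<close>. Admissible sets are closed under unions, and every
  countable set lies in a countable admissible one, so \<open>f\<close> can be extended along an increasing chain
  of admissible sets, adding countably many coordinates \<open>A' - A\<close> at a time. One such step is a
  fibrewise Knaster-Reichbach back-and-forth over the cube with coordinates \<open>A\<close>. It works if
  \<^item> \<open>P\<close> and \<open>K\<close>, projected to \<open>A'\<close>, are nowhere dense in every fibre over \<open>A\<close>; negligibility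
    provides such an \<open>A'\<close> as long as \<open>|A| <o \<kappa>\<close>; or
  \<^item> \<open>P\<close> and \<open>K\<close> depend only on the coordinates in \<open>A\<close>.

  Since \<open>P\<close> and \<open>K\<close> are closed and equal their \<open>\<kappa>\<close>-interiors, both depend on a common set \<open>C\<close> of at
  most \<open>\<kappa>\<close> coordinates. Treating the coordinates in \<open>C\<close> first, in order type at most \<open>\<kappa>\<close>, every step
  falls under one of the two cases.
\<close>

subsection \<open>Finite dependence\<close>

definition agree :: "'i set \<Rightarrow> ('i \<Rightarrow> 'b) \<Rightarrow> ('i \<Rightarrow> 'b) \<Rightarrow> bool" where
  "agree A x y \<longleftrightarrow> (\<forall>i\<in>A. x i = y i)"

text \<open>
  By compactness this is continuity of \<open>h\<close> on a closed set \<open>S\<close>, together with dependence on \<open>A\<close>.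
\<close>

definition fin_dep :: "('i \<Rightarrow> bool) set \<Rightarrow> 'i set \<Rightarrow> (('i \<Rightarrow> bool) \<Rightarrow> 'c) \<Rightarrow> bool" where
  "fin_dep S A h \<longleftrightarrow>
     (\<exists>E. finite E \<and> E \<subseteq> A \<and> (\<forall>x\<in>S. \<forall>y\<in>S. agree E x y \<longrightarrow> h x = h y))"

lemma fin_depI:
  assumes "finite E" and "E \<subseteq> A"
    and "\<And>x y. x \<in> S \<Longrightarrow> y \<in> S \<Longrightarrow> agree E x y \<Longrightarrow> h x = h y"
  shows "fin_dep S A h"
  unfolding fin_dep_def using assms by (intro exI[of _ E]) simp

lemma agree_refl [simp]: "agree A x x"
  by (simp add: agree_def)

lemma agree_sym: "agree A x y \<Longrightarrow> agree A y x"
  by (simp add: agree_def)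

lemma agree_trans: "agree A x y \<Longrightarrow> agree A y z \<Longrightarrow> agree A x z"
  by (simp add: agree_def)

lemma agree_cong: "agree A y y' \<Longrightarrow> agree A z y \<longleftrightarrow> agree A z y'"
  by (simp add: agree_def)

lemma agree_mono: "agree B x y \<Longrightarrow> A \<subseteq> B \<Longrightarrow> agree A x y"
  by (auto simp: agree_def)

lemma agree_Un: "agree (A \<union> B) x y \<longleftrightarrow> agree A x y \<and> agree B x y"
  by (auto simp: agree_def)

lemma fin_dep_const: "fin_dep S A (\<lambda>_. c)"
  unfolding fin_dep_def by blast

lemma fin_dep_coord: "i \<in> A \<Longrightarrow> fin_dep S A (\<lambda>x. x i)"
  unfolding fin_dep_def agree_def by (rule exI[of _ "{i}"]) auto

lemma fin_dep_mono: "fin_dep S A h \<Longrightarrow> A \<subseteq> B \<Longrightarrow> fin_dep S B h"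
  unfolding fin_dep_def by blast

lemma fin_dep_map2:
  assumes "fin_dep S A h" and "fin_dep S A k"
  shows "fin_dep S A (\<lambda>x. F (h x) (k x))"
proof -
  obtain E where E: "finite E" "E \<subseteq> A" "\<forall>x\<in>S. \<forall>y\<in>S. agree E x y \<longrightarrow> h x = h y"
    using assms(1) unfolding fin_dep_def by blast
  obtain G where G: "finite G" "G \<subseteq> A" "\<forall>x\<in>S. \<forall>y\<in>S. agree G x y \<longrightarrow> k x = k y"
    using assms(2) unfolding fin_dep_def by blast
  have *: "F (h x) (k x) = F (h y) (k y)" if "x \<in> S" "y \<in> S" "agree (E \<union> G) x y" for x y
    using that E(3) G(3) unfolding agree_Un by metis
  show ?thesis
    by (rule fin_depI[OF _ _ *]) (use E(1,2) G(1,2) in auto)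
qed

lemma fin_dep_coords:
  assumes "finite B" and "\<And>i. i \<in> B \<Longrightarrow> fin_dep S A (\<lambda>x. q x i)"
  shows "\<exists>E. finite E \<and> E \<subseteq> A \<and> (\<forall>x\<in>S. \<forall>y\<in>S. agree E x y \<longrightarrow> agree B (q x) (q y))"
proof -
  have "\<forall>i\<in>B. \<exists>E. finite E \<and> E \<subseteq> A \<and> (\<forall>x\<in>S. \<forall>y\<in>S. agree E x y \<longrightarrow> q x i = q y i)"
    using assms(2) unfolding fin_dep_def by blast
  then obtain E where E: "\<And>i. i \<in> B \<Longrightarrow> finite (E i)" "\<And>i. i \<in> B \<Longrightarrow> E i \<subseteq> A"
    "\<And>i x y. i \<in> B \<Longrightarrow> x \<in> S \<Longrightarrow> y \<in> S \<Longrightarrow> agree (E i) x y \<Longrightarrow> q x i = q y i"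
    by metis
  have "agree B (q x) (q y)" if "x \<in> S" "y \<in> S" "agree (\<Union>(E ` B)) x y" for x y
    unfolding agree_def[of B]
  proof
    fix i assume i: "i \<in> B"
    have "agree (E i) x y" using that(3) by (rule agree_mono) (use i in blast)
    then show "q x i = q y i" using E(3) i that by blast
  qed
  moreover have "finite (\<Union>(E ` B))" using E(1) assms(1) by blast
  moreover have "\<Union>(E ` B) \<subseteq> A" using E(2) by blast
  ultimately show ?thesis by blast
qed

lemma fin_dep_comp:
  assumes "fin_dep UNIV B h" and "\<And>i. i \<in> B \<Longrightarrow> fin_dep S A (\<lambda>x. q x i)"
  shows "fin_dep S A (\<lambda>x. h (q x))"
proof -
  obtain E where E: "finite E" "E \<subseteq> B" "\<And>x y. agree E x y \<Longrightarrow> h x = h y"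
    using assms(1) unfolding fin_dep_def by blast
  obtain G where G: "finite G" "G \<subseteq> A" "\<forall>x\<in>S. \<forall>y\<in>S. agree G x y \<longrightarrow> agree E (q x) (q y)"
    using fin_dep_coords[OF E(1), of S A q] assms(2) E(2) by blast
  have "h (q x) = h (q y)" if "x \<in> S" "y \<in> S" "agree G x y" for x y
    using G(3) that by (intro E(3)) simp
  then show ?thesis
    by (rule fin_depI[OF G(1,2)])
qed

text \<open>On \<open>S\<close> only the pattern of a point on a finite set \<open>E\<close>
  matters, so the value can be copied from any point of \<open>S\<close> with the same
  pattern.\<close>

lemma fin_dep_extend:
  assumes "fin_dep S A h"
  obtains e where "fin_dep UNIV A e" and "\<And>x. x \<in> S \<Longrightarrow> e x = h x"
proof -
  obtain E where E: "finite E" "E \<subseteq> A" "\<forall>x\<in>S. \<forall>y\<in>S. agree E x y \<longrightarrow> h x = h y"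
    using assms unfolding fin_dep_def by blast
  define e where "e y = h (SOME k. k \<in> S \<and> agree E k y)" for y
  have "e x = h x" if "x \<in> S" for x
  proof -
    have "(SOME k. k \<in> S \<and> agree E k x) \<in> S \<and> agree E (SOME k. k \<in> S \<and> agree E k x) x"
      by (rule someI[of _ x]) (simp add: that)
    then show ?thesis unfolding e_def using E(3) that by blast
  qed
  moreover have "e x = e y" if "agree E x y" for x y
  proof -
    \<comment> \<open>Equal predicates give equal choices, also for patterns that \<open>S\<close>
      does not realise, where the chosen value is an arbitrary default.\<close>
    have "(\<lambda>k. k \<in> S \<and> agree E k x) = (\<lambda>k. k \<in> S \<and> agree E k y)"
      using that by (meson agree_sym agree_trans)
    then show ?thesis by (simp add: e_def)
  qed
  then have "fin_dep UNIV A e" by (rule fin_depI[OF E(1,2)])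
  ultimately show ?thesis using that by blast
qed

subsection \<open>One step of the extension\<close>

text \<open>
  Only the coordinates in \<open>A\<close> of the values of \<open>\<phi>\<close> and \<open>\<psi>\<close> are meaningful: the pair encodes a
  homeomorphism of the cube with coordinates \<open>A\<close> and its inverse.
\<close>

definition partial_ext where
  "partial_ext P K f g A \<phi> \<psi> \<longleftrightarrow>
     (\<forall>i\<in>A. fin_dep UNIV A (\<lambda>x. \<phi> x i)) \<and> (\<forall>i\<in>A. fin_dep UNIV A (\<lambda>x. \<psi> x i)) \<and>
     (\<forall>x. agree A (\<psi> (\<phi> x)) x) \<and> (\<forall>x. agree A (\<phi> (\<psi> x)) x) \<and>
     (\<forall>x\<in>P. agree A (\<phi> x) (f x)) \<and> (\<forall>y\<in>K. agree A (\<psi> y) (g y))"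

lemma partial_ext_sym: "partial_ext P K f g A \<phi> \<psi> \<Longrightarrow> partial_ext K P g f A \<psi> \<phi>"
  unfolding partial_ext_def by blast

lemma fin_dep_agree:
  assumes "\<forall>i\<in>A. fin_dep UNIV A (\<lambda>x. q x i)" and "agree A x y"
  shows "agree A (q x) (q y)"
  using assms unfolding fin_dep_def agree_def by (metis UNIV_I subsetD)

text \<open>The fibre over a base point \<open>y\<close> of the range corresponds to the fibre over
  \<open>\<psi> y\<close> in the domain; this lets fibres on the two sides be compared.\<close>

lemma partial_ext_agree_iff:
  assumes "partial_ext P K f g A \<phi> \<psi>"
  shows "agree A (\<phi> x) y \<longleftrightarrow> agree A x (\<psi> y)"
proof
  assume "agree A (\<phi> x) y"
  then have "agree A (\<psi> (\<phi> x)) (\<psi> y)"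
    using assms fin_dep_agree unfolding partial_ext_def by blast
  then show "agree A x (\<psi> y)"
    using assms unfolding partial_ext_def by (meson agree_sym agree_trans)
next
  assume "agree A x (\<psi> y)"
  then have "agree A (\<phi> x) (\<phi> (\<psi> y))"
    using assms fin_dep_agree unfolding partial_ext_def by blast
  then show "agree A (\<phi> x) y"
    using assms unfolding partial_ext_def by (meson agree_trans)
qed

text \<open>A uniform form of nowhere density in the fibres over \<open>A\<close>: for given
  \<open>E\<close>, a single clopen set \<open>u\<close> works over all base points at once.\<close>

definition fibre_negligible where
  "fibre_negligible A A' K \<longleftrightarrow>
     (\<forall>E. finite E \<and> E \<subseteq> A' \<longrightarrow>
       (\<exists>u. fin_dep UNIV A' u \<and> (\<forall>y\<in>K. \<not> u y) \<and> (\<forall>y. \<exists>y'. agree (A \<union> E) y' y \<and> u y')))"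

definition depends_on where
  "depends_on P A \<longleftrightarrow> (\<forall>x y. x \<in> P \<and> agree A x y \<longrightarrow> y \<in> P)"

text \<open>
  A finite stage of the back-and-forth. The labels stand for the pieces of two matched clopen
  partitions; pieces with the same label must lie over the same points of the base.
\<close>

definition label_match where
  "label_match P f A \<phi> \<beta> \<gamma> \<longleftrightarrow>
     (\<forall>x y l. agree A (\<phi> x) y \<longrightarrow>
        (\<exists>x'. agree A x' x \<and> \<beta> x' = l) = (\<exists>y'. agree A y' y \<and> \<gamma> y' = l)) \<and>
     (\<forall>x\<in>P. \<gamma> (f x) = \<beta> x)"

definition inverse_on where
  "inverse_on P K f g \<longleftrightarrow>
     (\<forall>x\<in>P. f x \<in> K \<and> g (f x) = x) \<and> (\<forall>y\<in>K. g y \<in> P \<and> f (g y) = y)"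

text \<open>
  \<open>S y t l\<close> says which refined labels must occur over \<open>y\<close>, and \<open>D y t l\<close> which ones a clopen set
  \<open>e\<close> extending the image of \<open>b \<inter> P\<close> realises. Where \<open>e\<close> fails, it is corrected on a clopen set \<open>u\<close>
  disjoint from \<open>K\<close>, which is split in two by a fresh coordinate \<open>n\<close>.
\<close>

lemma label_match_refine:
  fixes \<beta> \<gamma> :: "('i \<Rightarrow> bool) \<Rightarrow> bool list"
  assumes inv: "inverse_on P K f g"
    and ext: "partial_ext P K f g A \<phi> \<psi>"
    and AA: "A \<subseteq> A'"
    and inf: "infinite (A' - A)"
    and adm: "\<forall>i\<in>A'. fin_dep K A' (\<lambda>y. g y i)"
    and hyp: "fibre_negligible A A' K \<or> depends_on P A"
    and fb: "fin_dep UNIV A' \<beta>" and fg: "fin_dep UNIV A' \<gamma>"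
    and match: "label_match P f A \<phi> \<beta> \<gamma>"
    and b: "fin_dep UNIV A' b"
  shows "\<exists>c. fin_dep UNIV A' c \<and> label_match P f A \<phi> (\<lambda>x. b x # \<beta> x) (\<lambda>y. c y # \<gamma> y)"
proof -
  note R = partial_ext_agree_iff[OF ext]
  have Rf: "agree A (\<phi> x) (f x)" if "x \<in> P" for x
    using ext that unfolding partial_ext_def by blast
  have "fin_dep K A' (\<lambda>y. b (g y))"
    by (rule fin_dep_comp[OF b]) (use adm in auto)
  then obtain e where e: "fin_dep UNIV A' e" and eK: "\<And>y. y \<in> K \<Longrightarrow> e y = b (g y)"
    using fin_dep_extend by blast
  define S where "S y t l \<longleftrightarrow> (\<exists>x. agree A (\<phi> x) y \<and> b x = t \<and> \<beta> x = l)" for y t l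
  define D where "D y t l \<longleftrightarrow> (\<exists>y'. agree A y' y \<and> e y' = t \<and> \<gamma> y' = l)" for y t l
  have S_cong: "S y t l = S y' t l" if "agree A y y'" for y y' t l
    unfolding S_def agree_cong[OF that] ..
  have D_cong: "D y t l = D y' t l" if "agree A y y'" for y y' t l
    unfolding D_def agree_cong[OF that] ..
  \<comment> \<open>The piece of \<open>y\<close> in its fibre has to be split in two, but
    \<open>e\<close> leaves it unsplit. This depends only on the base point and the label.\<close>
  define bad where "bad y \<longleftrightarrow> S y True (\<gamma> y) \<and> S y False (\<gamma> y) \<and>
    \<not> (D y True (\<gamma> y) \<and> D y False (\<gamma> y))" for y
  have bad_cong: "bad y = bad y'" if "agree A y y'" "\<gamma> y = \<gamma> y'" for y y'
    unfolding bad_def using S_cong[OF that(1)] D_cong[OF that(1)] that(2) by simp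
  have fS: "fin_dep UNIV A' (\<lambda>y. S y t)" for t
  proof -
    obtain E where E: "finite E" "E \<subseteq> A'" "\<And>x y. agree E x y \<Longrightarrow> (b x, \<beta> x) = (b y, \<beta> y)"
      using fin_dep_map2[OF b fb, of Pair] unfolding fin_dep_def by blast
    have psi: "\<forall>i\<in>A. fin_dep UNIV A (\<lambda>x. \<psi> x i)" using ext unfolding partial_ext_def by blast
    obtain G where G: "finite G" "G \<subseteq> A" "\<And>x y. agree G x y \<Longrightarrow> agree (A \<inter> E) (\<psi> x) (\<psi> y)"
      using fin_dep_coords[of "A \<inter> E" UNIV A \<psi>] psi E(1) by auto
    have *: "S z t l" if yz: "agree G y z" and "S y t l" for y z l
    proof -
      obtain x where x: "agree A x (\<psi> y)" "b x = t" "\<beta> x = l"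
        using \<open>S y t l\<close> unfolding S_def R by blast
      \<comment> \<open>The witness is transported to the fibre over \<open>z\<close> by replacing
        its base coordinates; as \<open>y\<close> and \<open>z\<close> agree on \<open>G\<close>,
        its values on \<open>E\<close> do not change.\<close>
      define w where "w i = (if i \<in> A then \<psi> z i else x i)" for i
      have "agree E w x"
        using G(3)[OF yz] x(1) by (auto simp: w_def agree_def)
      then have "b w = t \<and> \<beta> w = l" using E(3) x by blast
      moreover have "agree A w (\<psi> z)" by (simp add: w_def agree_def)
      ultimately show ?thesis unfolding S_def R by blast
    qed
    have "S y t = S z t" if "agree G y z" for y z
      using *[OF that] *[OF agree_sym[OF that]] by blast
    then show ?thesis by (rule fin_depI[OF G(1), rotated]) (use G(2) AA in auto)
  qed
  have fD: "fin_dep UNIV A' (\<lambda>y. D y t)" for t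
  proof -
    obtain E where E: "finite E" "E \<subseteq> A'" "\<And>x y. agree E x y \<Longrightarrow> (e x, \<gamma> x) = (e y, \<gamma> y)"
      using fin_dep_map2[OF e fg, of Pair] unfolding fin_dep_def by blast
    have *: "D z t l" if yz: "agree (A \<inter> E) y z" and "D y t l" for y z l
    proof -
      obtain x where x: "agree A x y" "e x = t" "\<gamma> x = l"
        using \<open>D y t l\<close> unfolding D_def by blast
      define w where "w i = (if i \<in> A then z i else x i)" for i
      have "agree E w x" using yz x(1) by (auto simp: w_def agree_def)
      then have "e w = t \<and> \<gamma> w = l" using E(3) x by blast
      moreover have "agree A w z" by (simp add: w_def agree_def)
      ultimately show ?thesis unfolding D_def by blast
    qed
    have "D y t = D z t" if "agree (A \<inter> E) y z" for y z
      using *[OF that] *[OF agree_sym[OF that]] by blast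
    then show ?thesis by (rule fin_depI[of "A \<inter> E", rotated 2]) (use E(1) AA in auto)
  qed
  have fSg: "fin_dep UNIV A' (\<lambda>y. S y t (\<gamma> y))" for t
    using fin_dep_map2[OF fS fg, of "\<lambda>p l. p l"] .
  have fDg: "fin_dep UNIV A' (\<lambda>y. D y t (\<gamma> y))" for t
    using fin_dep_map2[OF fD fg, of "\<lambda>p l. p l"] .
  have fbad: "fin_dep UNIV A' bad"
  proof -
    have "fin_dep UNIV A' (\<lambda>y. (S y True (\<gamma> y) \<and> S y False (\<gamma> y)) \<and> \<not> (D y True (\<gamma> y) \<and> D y False (\<gamma> y)))"
      by (rule fin_dep_map2[of _ _ _ _ "\<lambda>p q. p \<and> \<not> q"]; rule fin_dep_map2[of _ _ _ _ "(\<and>)"];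
          rule fSg fDg)
    then show ?thesis by (simp add: bad_def[abs_def])
  qed
  obtain u where u: "fin_dep UNIV A' u" and uK: "\<And>y. y \<in> K \<Longrightarrow> \<not> u y"
    and ubad: "\<And>y. bad y \<Longrightarrow> \<exists>y'. agree A y' y \<and> \<gamma> y' = \<gamma> y \<and> u y'"
  proof (use hyp in \<open>elim disjE\<close>)
    assume neg: "fibre_negligible A A' K"
    obtain E where E: "finite E" "E \<subseteq> A'" "\<And>x y. agree E x y \<Longrightarrow> \<gamma> x = \<gamma> y"
      using fg unfolding fin_dep_def by blast
    obtain u where u: "fin_dep UNIV A' u \<and> (\<forall>y\<in>K. \<not> u y) \<and>
        (\<forall>y. \<exists>y'. agree (A \<union> E) y' y \<and> u y')"
      using neg[unfolded fibre_negligible_def, rule_format, OF conjI[OF E(1,2)]] ..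
    have "\<exists>y'. agree A y' y \<and> \<gamma> y' = \<gamma> y \<and> u y'" for y
    proof -
      obtain y' where "agree (A \<union> E) y' y" "u y'" using u by meson
      then show ?thesis unfolding agree_Un by (intro exI[of _ y']) (simp add: E(3))
    qed
    then show ?thesis using that[of u] u by simp
  next
    \<comment> \<open>Here \<open>bad\<close> itself serves as \<open>u\<close>. Over the base point
      of a point of \<open>K\<close> the whole fibre of the domain lies in \<open>P\<close>, and
      \<open>f\<close> carries each witness for \<open>S\<close> to one for \<open>D\<close>,
      because \<open>e\<close> is correct on \<open>K\<close>.\<close>
    assume dep: "depends_on P A"
    have "\<not> bad y" if y: "y \<in> K" for y
    proof -
      have "D y t (\<gamma> y)" if "S y t (\<gamma> y)" for t
      proof -
        obtain x where x: "agree A (\<phi> x) y" "b x = t" "\<beta> x = \<gamma> y"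
          using \<open>S y t (\<gamma> y)\<close> unfolding S_def by blast
        have gy: "g y \<in> P" "f (g y) = y" using inv y unfolding inverse_on_def by auto
        have "agree A (g y) (\<psi> y)" using Rf[OF gy(1)] gy(2) R by metis
        moreover have "agree A x (\<psi> y)" using x(1) R by blast
        ultimately have "agree A (g y) x" by (meson agree_sym agree_trans)
        then have xP: "x \<in> P" using dep gy(1) unfolding depends_on_def by blast
        have "agree A (f x) y" using Rf[OF xP] x(1) by (meson agree_sym agree_trans)
        moreover have "e (f x) = t" using eK inv xP x(2) unfolding inverse_on_def by metis
        moreover have "\<gamma> (f x) = \<gamma> y" using match xP x(3) unfolding label_match_def by metis
        ultimately show ?thesis unfolding D_def by blast
      qed
      then show ?thesis unfolding bad_def by blast
    qed
    moreover have "\<exists>y'. agree A y' y \<and> \<gamma> y' = \<gamma> y \<and> bad y'" if "bad y" for y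
      using that by (intro exI[of _ y]) simp
    ultimately show ?thesis by (rule that[OF fbad])
  qed
  obtain E where E: "finite E" "\<And>x y. agree E x y \<Longrightarrow> (u x, \<gamma> x) = (u y, \<gamma> y)"
    using fin_dep_map2[OF u fg, of Pair] unfolding fin_dep_def by blast
  \<comment> \<open>Changing coordinate \<open>n\<close> affects neither the base point nor the
    label nor membership in \<open>u\<close>, so both values of \<open>n\<close> occur in
    \<open>u\<close> within each bad piece.\<close>
  obtain n where n: "n \<in> A'" "n \<notin> A" "n \<notin> E"
    using inf E(1) by (meson Diff_iff finite_subset subsetI)
  \<comment> \<open>If only one refined label is required, \<open>c\<close> takes it on the whole
    piece. If both are required, \<open>c\<close> follows \<open>e\<close>, except on
    \<open>u\<close> in bad pieces, where coordinate \<open>n\<close> forces both values.\<close>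
  define c where "c y \<longleftrightarrow> S y True (\<gamma> y) \<and>
    (S y False (\<gamma> y) \<longrightarrow> (if bad y \<and> u y then y n else e y))" for y
  have fc: "fin_dep UNIV A' c"
  proof -
    note bu = fin_dep_map2[OF fbad u, of "(\<and>)"]
    note yn = fin_dep_map2[OF bu fin_dep_coord[OF n(1)], of "(\<longrightarrow>)"]
    note ye = fin_dep_map2[OF bu e, of "\<lambda>p q. \<not> p \<longrightarrow> q"]
    note ite = fin_dep_map2[OF yn ye, of "(\<and>)"]
    note imp = fin_dep_map2[OF fSg[of False] ite, of "(\<longrightarrow>)"]
    show ?thesis
      using fin_dep_map2[OF fSg[of True] imp, of "(\<and>)"]
      by (simp add: c_def[abs_def] if_bool_eq_conj)
  qed
  have nlabel: "\<exists>y'. agree A y' y \<and> \<gamma> y' = \<gamma> y \<and> u y' \<and> y' n = t" if "bad y" for y t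
  proof -
    obtain y' where y': "agree A y' y" "\<gamma> y' = \<gamma> y" "u y'" using ubad[OF \<open>bad y\<close>] by blast
    have E': "agree E (y'(n := t)) y'" using n by (auto simp: agree_def)
    have "u (y'(n := t)) \<and> \<gamma> (y'(n := t)) = \<gamma> y" using E(2)[OF E'] y' by simp
    moreover have "agree A (y'(n := t)) y" using y'(1) n by (auto simp: agree_def)
    ultimately show ?thesis by (metis fun_upd_same)
  qed
  have S_iff: "(\<exists>t. S y t l) \<longleftrightarrow> (\<exists>y'. agree A y' y \<and> \<gamma> y' = l)" for y l
  proof -
    have "agree A (\<phi> (\<psi> y)) y" using R by simp
    then have "(\<exists>x'. agree A x' (\<psi> y) \<and> \<beta> x' = l) = (\<exists>y'. agree A y' y \<and> \<gamma> y' = l)"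
      by (rule match[unfolded label_match_def, THEN conjunct1, rule_format])
    then show ?thesis unfolding S_def R by auto
  qed
  have key: "S y t l \<longleftrightarrow> (\<exists>y'. agree A y' y \<and> c y' = t \<and> \<gamma> y' = l)" for y t l
  proof
    assume "\<exists>y'. agree A y' y \<and> c y' = t \<and> \<gamma> y' = l"
    then obtain y' where y': "agree A y' y" "c y' = t" "\<gamma> y' = l" by blast
    have "\<exists>s. S y' s l" unfolding S_iff using y'(3) by (intro exI[of _ y']) simp
    then obtain s where "S y' s l" ..
    then have "S y' t l" using y'(2,3) unfolding c_def by (metis (full_types))
    then show "S y t l" using S_cong[OF y'(1)] by simp
  next
    assume S: "S y t l"
    then obtain y' where y': "agree A y' y" "\<gamma> y' = l" using S_iff[of y l] by auto
    have S': "S y' t l" using S S_cong[OF y'(1)] by simp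
    show "\<exists>y'. agree A y' y \<and> c y' = t \<and> \<gamma> y' = l"
    proof (cases "S y' (\<not> t) l")
      case False
      then have "c y' = t" using S' y'(2) unfolding c_def by (cases t) auto
      then show ?thesis using y' by auto
    next
      case True
      then have both: "S y' True l" "S y' False l" using S' by (cases t; simp)+
      show ?thesis
      proof (cases "bad y'")
        case True
        then obtain w where w: "agree A w y'" "\<gamma> w = \<gamma> y'" "u w" "w n = t"
          using nlabel[OF True, of t] by auto
        have "bad w" using bad_cong[OF w(1,2)] True by simp
        moreover have "S w True (\<gamma> w)" "S w False (\<gamma> w)"
          using both S_cong[OF w(1)] w(2) y'(2) by auto
        ultimately have "c w = t" using w unfolding c_def by simp
        then show ?thesis using w y' by (metis agree_trans)
      next
        case False
        then have "D y' t l" using both y'(2) unfolding bad_def by (cases t) auto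
        then obtain w where w: "agree A w y'" "e w = t" "\<gamma> w = l" unfolding D_def by blast
        have "\<not> bad w" using bad_cong[OF w(1)] w(3) y'(2) False by simp
        moreover have "S w True (\<gamma> w)" "S w False (\<gamma> w)"
          using both S_cong[OF w(1)] w(3) by auto
        ultimately have "c w = t" using w unfolding c_def by simp
        then show ?thesis using w y' by (metis agree_trans)
      qed
    qed
  qed
  have "label_match P f A \<phi> (\<lambda>x. b x # \<beta> x) (\<lambda>y. c y # \<gamma> y)"
    unfolding label_match_def
  proof (intro conjI allI impI ballI)
    fix x y and l :: "bool list"
    assume xy: "agree A (\<phi> x) y"
    have 1: "agree A x' x \<longleftrightarrow> agree A (\<phi> x') y" for x'
      using xy unfolding R by (meson agree_sym agree_trans)
    show "(\<exists>x'. agree A x' x \<and> b x' # \<beta> x' = l) = (\<exists>y'. agree A y' y \<and> c y' # \<gamma> y' = l)"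
      using key[of y] unfolding S_def 1 by (cases l) auto
  next
    fix x assume x: "x \<in> P"
    have fx: "f x \<in> K" "g (f x) = x" using inv x unfolding inverse_on_def by auto
    have l: "\<gamma> (f x) = \<beta> x" using match x unfolding label_match_def by blast
    \<comment> \<open>The point \<open>x\<close> itself makes its own label required over
      \<open>f x\<close>. Since \<open>f x\<close> avoids \<open>u\<close>, \<open>c\<close> follows
      \<open>e\<close> there whenever it has a choice.\<close>
    have "S (f x) (b x) (\<gamma> (f x))" unfolding S_def using Rf[OF x] l by metis
    moreover have "e (f x) = b x" using eK fx by metis
    ultimately have "c (f x) = b x" unfolding c_def using uK[OF fx(1)] by (cases "b x") auto
    then show "c (f x) # \<gamma> (f x) = b x # \<beta> x" using l by simp
  qed
  then show ?thesis using fc by blast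
qed

text \<open>The matching is symmetric in the two sides, so one refinement lemma yields both the
  forth and the back moves.\<close>

lemma label_match_sym:
  assumes inv: "inverse_on P K f g" and ext: "partial_ext P K f g A \<phi> \<psi>"
    and match: "label_match P f A \<phi> \<beta> \<gamma>"
  shows "label_match K g A \<psi> \<gamma> \<beta>"
  unfolding label_match_def
proof (intro conjI allI impI ballI)
  fix x y l
  assume xy: "agree A (\<psi> x) y"
  then have "agree A (\<phi> y) x"
    using partial_ext_agree_iff[OF ext] agree_sym by metis
  then show "(\<exists>x'. agree A x' x \<and> \<gamma> x' = l) = (\<exists>y'. agree A y' y \<and> \<beta> y' = l)"
    by (rule match[unfolded label_match_def, THEN conjunct1, rule_format, symmetric])
next
  fix y assume "y \<in> K"
  then have "g y \<in> P" "f (g y) = y" using inv unfolding inverse_on_def by auto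
  then show "\<beta> (g y) = \<gamma> y" using match unfolding label_match_def by metis
qed

lemma inverse_on_sym: "inverse_on P K f g \<Longrightarrow> inverse_on K P g f"
  unfolding inverse_on_def by blast

text \<open>One forth and one back move. Coordinate \<open>n\<close> is prescribed first on the
  domain, answered by \<open>c\<close>, and then on the range, answered by \<open>b\<close>. Equal
  labels thus equate \<open>b x\<close> with \<open>y n\<close> and \<open>x n\<close> with
  \<open>c y\<close>, so \<open>b\<close> and \<open>c\<close> can become coordinate
  \<open>n\<close> of the two maps.\<close>

lemma label_match_refine_both:
  fixes \<beta> \<gamma> :: "('i \<Rightarrow> bool) \<Rightarrow> bool list"
  assumes inv: "inverse_on P K f g"
    and ext: "partial_ext P K f g A \<phi> \<psi>"
    and AA: "A \<subseteq> A'"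
    and inf: "infinite (A' - A)"
    and admf: "\<forall>i\<in>A'. fin_dep P A' (\<lambda>x. f x i)"
    and admg: "\<forall>i\<in>A'. fin_dep K A' (\<lambda>y. g y i)"
    and hyp: "fibre_negligible A A' P \<and> fibre_negligible A A' K \<or> depends_on P A \<and> depends_on K A"
    and fb: "fin_dep UNIV A' \<beta>" and fg: "fin_dep UNIV A' \<gamma>"
    and match: "label_match P f A \<phi> \<beta> \<gamma>"
    and n: "n \<in> A'"
  shows "\<exists>b c. fin_dep UNIV A' b \<and> fin_dep UNIV A' c \<and>
     label_match P f A \<phi> (\<lambda>x. b x # x n # \<beta> x) (\<lambda>y. y n # c y # \<gamma> y)"
proof -
  note fn = fin_dep_coord[OF n, of UNIV]
  have hK: "fibre_negligible A A' K \<or> depends_on P A" and hP: "fibre_negligible A A' P \<or> depends_on K A"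
    using hyp by auto
  obtain c where c: "fin_dep UNIV A' c"
      "label_match P f A \<phi> (\<lambda>x. x n # \<beta> x) (\<lambda>y. c y # \<gamma> y)"
    using label_match_refine[OF inv ext AA inf admg hK fb fg match fn] by auto
  obtain b where b: "fin_dep UNIV A' b"
      "label_match K g A \<psi> (\<lambda>y. y n # c y # \<gamma> y) (\<lambda>x. b x # x n # \<beta> x)"
    using label_match_refine[OF inverse_on_sym[OF inv] partial_ext_sym[OF ext] AA inf admf hP
        fin_dep_map2[OF c(1) fg, of "(#)"] fin_dep_map2[OF fn fb, of "(#)"]
        label_match_sym[OF inv ext c(2)] fn] by auto
  show ?thesis
    using label_match_sym[OF inverse_on_sym[OF inv] partial_ext_sym[OF ext] b(2)] b(1) c(1) by auto
qed

section \<open>The limit of the back-and-forth\<close>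

text \<open>The matching supplies a point \<open>y\<close> over the base point of
  \<open>\<phi>' x\<close> with the stage-\<open>k\<close> label of \<open>x\<close>. For large
  \<open>k\<close> it agrees with \<open>\<phi>' x\<close> on the finite support of
  \<open>c j\<close>, and the label records that \<open>c j y\<close> is
  \<open>x (e j)\<close>.\<close>

lemma back_and_forth_inverse:
  fixes e :: "nat \<Rightarrow> 'i"
  assumes ext: "partial_ext P K f g A \<phi> \<psi>"
    and N: "A' = A \<union> range e"
    and match: "\<And>k. label_match P f A \<phi> (\<beta> k) (\<gamma> k)"
    and labels: "\<And>k x y. \<beta> k x = \<gamma> k y \<Longrightarrow> \<forall>j<k. b j x = y (e j) \<and> x (e j) = c j y"
    and fc: "\<And>j. fin_dep UNIV A' (c j)"
    and \<phi>': "\<And>x i. i \<in> A \<Longrightarrow> \<phi>' x i = \<phi> x i" "\<And>x j. \<phi>' x (e j) = b j x"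
    and \<psi>': "\<And>y i. i \<in> A \<Longrightarrow> \<psi>' y i = \<psi> y i" "\<And>y j. \<psi>' y (e j) = c j y"
  shows "agree A' (\<psi>' (\<phi>' x)) x"
  unfolding agree_def
proof
  have psi: "\<forall>i\<in>A. fin_dep UNIV A (\<lambda>x. \<psi> x i)" using ext unfolding partial_ext_def by blast
  have A: "agree A (\<phi>' x) (\<phi> x)" by (simp add: agree_def \<phi>')
  fix i assume "i \<in> A'"
  then consider "i \<in> A" | j where "i = e j" using N by auto
  then show "\<psi>' (\<phi>' x) i = x i"
  proof cases
    case 1
    have "agree A (\<psi> (\<phi>' x)) (\<psi> (\<phi> x))" by (rule fin_dep_agree[OF psi A])
    moreover have "agree A (\<psi> (\<phi> x)) x" using ext unfolding partial_ext_def by blast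
    ultimately show ?thesis using 1 \<psi>'(1) by (simp add: agree_def)
  next
    case 2
    obtain E where E: "finite E" "E \<subseteq> A'" "\<And>x y. agree E x y \<Longrightarrow> c j x = c j y"
      using fc[of j] unfolding fin_dep_def by auto
    have "\<forall>i\<in>E - A. \<exists>k. i = e k" using E(2) N by auto
    then obtain idx where idx: "\<And>i. i \<in> E - A \<Longrightarrow> i = e (idx i)" by metis
    obtain m where m: "\<And>i. i \<in> E - A \<Longrightarrow> idx i \<le> m"
      using finite_nat_set_iff_bounded_le[of "idx ` (E - A)"] E(1) by auto
    \<comment> \<open>Labels of stage \<open>k\<close> record the indices below \<open>k\<close>;
      the successor makes them cover \<open>j\<close> and all of \<open>E\<close> outside
      \<open>A\<close>.\<close>
    define k where "k = Suc (max j m)"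
    have "(\<exists>x'. agree A x' x \<and> \<beta> k x' = \<beta> k x) = (\<exists>y'. agree A y' (\<phi>' x) \<and> \<gamma> k y' = \<beta> k x)"
      by (rule match[of k, unfolded label_match_def, THEN conjunct1, rule_format])
        (rule agree_sym[OF A])
    then have "\<exists>y'. agree A y' (\<phi>' x) \<and> \<gamma> k y' = \<beta> k x"
      using agree_refl by blast
    then obtain y where y: "agree A y (\<phi>' x)" "\<gamma> k y = \<beta> k x" by auto
    have l: "b i x = y (e i) \<and> x (e i) = c i y" if "i < k" for i
      using labels[of k x y] y(2) that by simp
    have "y i = \<phi>' x i" if "i \<in> E" for i
    proof (cases "i \<in> A")
      case True
      then show ?thesis using y(1) by (simp add: agree_def)
    next
      case False
      then have i: "i = e (idx i)" "idx i < k" using idx[of i] m[of i] that by (auto simp: k_def)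
      show ?thesis using l[OF i(2)] \<phi>'(2)[of x "idx i"] i(1) by simp
    qed
    then have "c j y = c j (\<phi>' x)" by (intro E(3)) (simp add: agree_def)
    moreover have "x (e j) = c j y" using l[of j] by (simp add: k_def)
    ultimately show ?thesis using 2 \<psi>'(2) by simp
  qed
qed

text \<open>The new coordinates are enumerated by \<open>e\<close>, and the \<open>n\<close>-th pair
  of moves handles \<open>e n\<close>. The answers \<open>b n\<close> and \<open>c n\<close> become
  coordinate \<open>e n\<close> of \<open>\<phi>'\<close> and \<open>\<psi>'\<close>; they depend on
  finitely many coordinates, so both maps stay continuous.\<close>

lemma partial_ext_step:
  fixes P K :: "('i \<Rightarrow> bool) set"
  assumes inv: "inverse_on P K f g"
    and ext: "partial_ext P K f g A \<phi> \<psi>"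
    and AA: "A \<subseteq> A'"
    and inf: "infinite (A' - A)"
    and cnt: "countable (A' - A)"
    and admf: "\<forall>i\<in>A'. fin_dep P A' (\<lambda>x. f x i)"
    and admg: "\<forall>i\<in>A'. fin_dep K A' (\<lambda>y. g y i)"
    and hyp: "fibre_negligible A A' P \<and> fibre_negligible A A' K \<or> depends_on P A \<and> depends_on K A"
  shows "\<exists>\<phi>' \<psi>'. partial_ext P K f g A' \<phi>' \<psi>' \<and>
    (\<forall>x. agree A (\<phi>' x) (\<phi> x) \<and> agree A (\<psi>' x) (\<psi> x))"
proof -
  define e where "e = from_nat_into (A' - A)"
  have e: "bij_betw e UNIV (A' - A)"
    unfolding e_def using bij_betw_from_nat_into[OF cnt inf] .
  have re: "range e = A' - A" and inj: "inj e"
    using e by (auto simp: bij_betw_def)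
  have N: "A' = A \<union> range e" using re AA by auto
  define good where "good s \<longleftrightarrow> fin_dep UNIV A' (fst s) \<and> fin_dep UNIV A' (snd s) \<and>
      label_match P f A \<phi> (fst s) (snd s)"
    for s :: "(('i \<Rightarrow> bool) \<Rightarrow> bool list) \<times> (('i \<Rightarrow> bool) \<Rightarrow> bool list)"
  define ref where "ref n s s' \<longleftrightarrow> (\<exists>b c. fin_dep UNIV A' b \<and> fin_dep UNIV A' c \<and>
      fst s' = (\<lambda>x. b x # x (e n) # fst s x) \<and> snd s' = (\<lambda>y. y (e n) # c y # snd s y))"
    for n :: nat and s s' :: "(('i \<Rightarrow> bool) \<Rightarrow> bool list) \<times> (('i \<Rightarrow> bool) \<Rightarrow> bool list)"
  have "\<exists>s. \<forall>n. (good (s n) \<and> (n = 0 \<longrightarrow> s n = (\<lambda>_. [], \<lambda>_. []))) \<and> ref n (s n) (s (Suc n))"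
  proof (rule dependent_nat_choice)
    have "good (\<lambda>_. [], \<lambda>_. [])"
      unfolding good_def label_match_def by (auto intro: fin_dep_const agree_refl)
    then show "\<exists>s. good s \<and> (0 = (0::nat) \<longrightarrow> s = (\<lambda>_. [], \<lambda>_. []))" by auto
  next
    fix s and n :: nat
    assume "good s \<and> (n = 0 \<longrightarrow> s = (\<lambda>_. [], \<lambda>_. []))"
    then have s: "fin_dep UNIV A' (fst s)" "fin_dep UNIV A' (snd s)"
      "label_match P f A \<phi> (fst s) (snd s)" unfolding good_def by auto
    have n: "e n \<in> A'" using re by auto
    obtain b c where bc: "fin_dep UNIV A' b" "fin_dep UNIV A' c"
      "label_match P f A \<phi> (\<lambda>x. b x # x (e n) # fst s x) (\<lambda>y. y (e n) # c y # snd s y)"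
      using label_match_refine_both[OF inv ext AA inf admf admg hyp s n] by auto
    note fn = fin_dep_coord[OF n, of UNIV]
    have "good (\<lambda>x. b x # x (e n) # fst s x, \<lambda>y. y (e n) # c y # snd s y)"
      unfolding good_def fst_conv snd_conv
      by (intro conjI bc(3) fin_dep_map2[of _ _ _ _ "(#)"] bc(1,2) s fn)
    moreover have "ref n s (\<lambda>x. b x # x (e n) # fst s x, \<lambda>y. y (e n) # c y # snd s y)"
      unfolding ref_def using bc(1,2) by auto
    ultimately show "\<exists>s'. (good s' \<and> (Suc n = 0 \<longrightarrow> s' = (\<lambda>_. [], \<lambda>_. []))) \<and> ref n s s'"
      by auto
  qed
  then obtain s where s: "\<And>n. good (s n)" "s 0 = (\<lambda>_. [], \<lambda>_. [])" "\<And>n. ref n (s n) (s (Suc n))"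
    by auto
  have "\<forall>n. \<exists>b c. fin_dep UNIV A' b \<and> fin_dep UNIV A' c \<and>
      fst (s (Suc n)) = (\<lambda>x. b x # x (e n) # fst (s n) x) \<and>
      snd (s (Suc n)) = (\<lambda>y. y (e n) # c y # snd (s n) y)"
    using s(3) unfolding ref_def by simp
  from choice[OF this] obtain b where "\<forall>n. \<exists>c. fin_dep UNIV A' (b n) \<and> fin_dep UNIV A' c \<and>
      fst (s (Suc n)) = (\<lambda>x. b n x # x (e n) # fst (s n) x) \<and>
      snd (s (Suc n)) = (\<lambda>y. y (e n) # c y # snd (s n) y)" ..
  from choice[OF this] obtain c where "\<forall>n. fin_dep UNIV A' (b n) \<and> fin_dep UNIV A' (c n) \<and>
      fst (s (Suc n)) = (\<lambda>x. b n x # x (e n) # fst (s n) x) \<and>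
      snd (s (Suc n)) = (\<lambda>y. y (e n) # c n y # snd (s n) y)" ..
  then have bc: "\<And>n. fin_dep UNIV A' (b n)" "\<And>n. fin_dep UNIV A' (c n)"
      "\<And>n. fst (s (Suc n)) = (\<lambda>x. b n x # x (e n) # fst (s n) x)"
      "\<And>n. snd (s (Suc n)) = (\<lambda>y. y (e n) # c n y # snd (s n) y)"
    by simp_all
  have match: "label_match P f A \<phi> (fst (s k)) (snd (s k))" for k
    using s(1)[of k] unfolding good_def by simp
  have labels: "fst (s k) x = snd (s k) y \<Longrightarrow> \<forall>j<k. b j x = y (e j) \<and> x (e j) = c j y" for k x y
    by (induction k) (auto simp: bc less_Suc_eq)
  define \<phi>' where "\<phi>' x i = (if i \<in> A then \<phi> x i else b (inv e i) x)" for x i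
  define \<psi>' where "\<psi>' y i = (if i \<in> A then \<psi> y i else c (inv e i) y)" for y i
  \<comment> \<open>On \<open>P\<close> the points \<open>x\<close> and \<open>f x\<close> carry
    equal labels at every stage, so the recorded answers force \<open>\<phi>'\<close> to extend
    \<open>f\<close> and \<open>\<psi>'\<close> to extend \<open>g\<close>.\<close>
  have label_f: "\<forall>j<k. b j x = f x (e j) \<and> x (e j) = c j (f x)" if "x \<in> P" for k x
  proof (rule labels)
    show "fst (s k) x = snd (s k) (f x)"
      using match[of k] that unfolding label_match_def by simp
  qed
  have eA: "e j \<notin> A" for j using re by auto
  have \<phi>'1: "\<phi>' x i = \<phi> x i" if "i \<in> A" for x i using that by (simp add: \<phi>'_def)
  have \<psi>'1: "\<psi>' x i = \<psi> x i" if "i \<in> A" for x i using that by (simp add: \<psi>'_def)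
  have \<phi>'2: "\<phi>' x (e j) = b j x" for x j using eA inj by (simp add: \<phi>'_def)
  have \<psi>'2: "\<psi>' x (e j) = c j x" for x j using eA inj by (simp add: \<psi>'_def)
  have cases: "Q i" if "i \<in> A'" "\<And>i. i \<in> A \<Longrightarrow> Q i" "\<And>j. Q (e j)" for Q i
    using that N by auto
  have "partial_ext P K f g A' \<phi>' \<psi>'"
    unfolding partial_ext_def
  proof (intro conjI allI ballI)
    fix i assume i: "i \<in> A'"
    show "fin_dep UNIV A' (\<lambda>x. \<phi>' x i)"
      using i by (rule cases)
        (use ext AA in \<open>auto simp: \<phi>'1 \<phi>'2 bc partial_ext_def intro: fin_dep_mono\<close>)
    show "fin_dep UNIV A' (\<lambda>x. \<psi>' x i)"
      using i by (rule cases)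
        (use ext AA in \<open>auto simp: \<psi>'1 \<psi>'2 bc partial_ext_def intro: fin_dep_mono\<close>)
  next
    fix x
    show "agree A' (\<psi>' (\<phi>' x)) x"
      by (rule back_and_forth_inverse[OF ext N match labels bc(2) \<phi>'1 \<phi>'2 \<psi>'1 \<psi>'2])
    show "agree A' (\<phi>' (\<psi>' x)) x"
    proof (rule back_and_forth_inverse[OF partial_ext_sym[OF ext] N _ _ bc(1) \<psi>'1 \<psi>'2 \<phi>'1 \<phi>'2])
      show "label_match K g A \<psi> (snd (s k)) (fst (s k))" for k
        by (rule label_match_sym[OF inv ext match])
      show "\<forall>j<k. c j x = y (e j) \<and> x (e j) = b j y" if "snd (s k) x = fst (s k) y" for k x y
        using labels[OF that[symmetric]] by simp
    qed
  next
    fix x assume x: "x \<in> P"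
    show "agree A' (\<phi>' x) (f x)"
      unfolding agree_def
    proof
      fix i assume "i \<in> A'"
      then show "\<phi>' x i = f x i"
      proof (rule cases)
        show "\<phi>' x i = f x i" if "i \<in> A" for i
          using that ext x unfolding partial_ext_def agree_def by (simp add: \<phi>'1)
        show "\<phi>' x (e j) = f x (e j)" for j
          using label_f[OF x, of "Suc j"] by (simp add: \<phi>'2)
      qed
    qed
  next
    fix y assume y: "y \<in> K"
    have gy: "g y \<in> P" "f (g y) = y" using inv y unfolding inverse_on_def by auto
    show "agree A' (\<psi>' y) (g y)"
      unfolding agree_def
    proof
      fix i assume "i \<in> A'"
      then show "\<psi>' y i = g y i"
      proof (rule cases)
        show "\<psi>' y i = g y i" if "i \<in> A" for i
          using that ext y unfolding partial_ext_def agree_def by (simp add: \<psi>'1)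
        show "\<psi>' y (e j) = g y (e j)" for j
          using label_f[OF gy(1), of "Suc j"] gy(2) by (simp add: \<psi>'2)
      qed
    qed
  qed
  moreover have "agree A (\<phi>' x) (\<phi> x) \<and> agree A (\<psi>' x) (\<psi> x)" for x
    by (simp add: agree_def \<phi>'1 \<psi>'1)
  ultimately show ?thesis by blast
qed

subsection \<open>Transfinite iteration\<close>

text \<open>A coordinate of the union is read off any member that contains it; by coherence the
  choice is immaterial. Its finite support lies in that member, so continuity passes to the
  union.\<close>

lemma partial_ext_directed_union:
  assumes ext: "\<And>j. j \<in> I \<Longrightarrow> partial_ext P K f g (A j) (\<phi> j) (\<psi> j)"
    and chain: "\<And>j k. j \<in> I \<Longrightarrow> k \<in> I \<Longrightarrow> A j \<subseteq> A k \<or> A k \<subseteq> A j"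
    and coherent: "\<And>j k x. j \<in> I \<Longrightarrow> k \<in> I \<Longrightarrow> A j \<subseteq> A k \<Longrightarrow>
      agree (A j) (\<phi> j x) (\<phi> k x) \<and> agree (A j) (\<psi> j x) (\<psi> k x)"
  shows "\<exists>\<Phi> \<Psi>. partial_ext P K f g (\<Union>j\<in>I. A j) \<Phi> \<Psi> \<and>
    (\<forall>j\<in>I. \<forall>x. agree (A j) (\<phi> j x) (\<Phi> x) \<and> agree (A j) (\<psi> j x) (\<Psi> x))"
proof -
  define idx where "idx i = (SOME j. j \<in> I \<and> i \<in> A j)" for i
  have idx: "idx i \<in> I \<and> i \<in> A (idx i)" if "j \<in> I" "i \<in> A j" for i j
    unfolding idx_def by (rule someI[of _ j]) (use that in simp)
  define \<Phi> where "\<Phi> x i = \<phi> (idx i) x i" for x i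
  define \<Psi> where "\<Psi> x i = \<psi> (idx i) x i" for x i
  have eq: "\<phi> j x i = \<Phi> x i \<and> \<psi> j x i = \<Psi> x i" if "j \<in> I" "i \<in> A j" for i j x
  proof -
    have k: "idx i \<in> I" "i \<in> A (idx i)" using idx[OF that] by auto
    show ?thesis
      using chain[OF that(1) k(1)] coherent[OF that(1) k(1), of x] coherent[OF k(1) that(1), of x] that(2) k(2)
      unfolding \<Phi>_def \<Psi>_def agree_def by auto
  qed
  then have ag: "agree (A j) (\<phi> j x) (\<Phi> x)" "agree (A j) (\<psi> j x) (\<Psi> x)" if "j \<in> I" for j x
    using that by (auto simp: agree_def)
  have "partial_ext P K f g (\<Union>j\<in>I. A j) \<Phi> \<Psi>"
    unfolding partial_ext_def
  proof (intro conjI ballI allI)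
    fix i assume "i \<in> (\<Union>j\<in>I. A j)"
    then obtain j where j: "j \<in> I" "i \<in> A j" by auto
    have fd: "fin_dep UNIV (A j) (\<lambda>x. \<phi> j x i)" "fin_dep UNIV (A j) (\<lambda>x. \<psi> j x i)"
      using ext[OF j(1)] j(2) unfolding partial_ext_def by auto
    have sub: "A j \<subseteq> (\<Union>j\<in>I. A j)" using j by auto
    show "fin_dep UNIV (\<Union>j\<in>I. A j) (\<lambda>x. \<Phi> x i)" "fin_dep UNIV (\<Union>j\<in>I. A j) (\<lambda>x. \<Psi> x i)"
      using fin_dep_mono[OF fd(1) sub] fin_dep_mono[OF fd(2) sub] by (simp_all add: eq[OF j])
  next
    fix x
    have inv: "agree (A j) (\<Psi> (\<Phi> x)) x \<and> agree (A j) (\<Phi> (\<Psi> x)) x" if j: "j \<in> I" for j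
    proof -
      have e: "\<forall>i\<in>A j. fin_dep UNIV (A j) (\<lambda>x. \<phi> j x i)" "\<forall>i\<in>A j. fin_dep UNIV (A j) (\<lambda>x. \<psi> j x i)"
        "agree (A j) (\<psi> j (\<phi> j x)) x" "agree (A j) (\<phi> j (\<psi> j x)) x"
        using ext[OF j] unfolding partial_ext_def by simp_all
      have "agree (A j) (\<psi> j (\<phi> j x)) (\<psi> j (\<Phi> x))" "agree (A j) (\<phi> j (\<psi> j x)) (\<phi> j (\<Psi> x))"
        using fin_dep_agree[OF e(2) ag(1)[OF j]] fin_dep_agree[OF e(1) ag(2)[OF j]] by auto
      then show ?thesis
        using e(3,4) ag[OF j] by (meson agree_sym agree_trans)
    qed
    show "agree (\<Union>j\<in>I. A j) (\<Psi> (\<Phi> x)) x" "agree (\<Union>j\<in>I. A j) (\<Phi> (\<Psi> x)) x"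
      using inv by (auto simp: agree_def)
  next
    fix x assume "x \<in> P"
    then have "agree (A j) (\<phi> j x) (f x)" if "j \<in> I" for j
      using ext[OF that] unfolding partial_ext_def by simp
    then have "agree (A j) (\<Phi> x) (f x)" if "j \<in> I" for j
      using ag[OF that] that by (meson agree_sym agree_trans)
    then show "agree (\<Union>j\<in>I. A j) (\<Phi> x) (f x)" by (auto simp: agree_def)
  next
    fix x assume "x \<in> K"
    then have "agree (A j) (\<psi> j x) (g x)" if "j \<in> I" for j
      using ext[OF that] unfolding partial_ext_def by simp
    then have "agree (A j) (\<Psi> x) (g x)" if "j \<in> I" for j
      using ag[OF that] that by (meson agree_sym agree_trans)
    then show "agree (\<Union>j\<in>I. A j) (\<Psi> x) (g x)" by (auto simp: agree_def)
  qed
  with ag show ?thesis by blast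
qed

text \<open>\<open>U i\<close> collects the blocks up to and including \<open>i\<close>. The maps
  for the predecessors are merged over the union of their blocks, and then \<open>step\<close> adds
  \<open>M i\<close>; first, successor and limit stages are treated alike.\<close>

lemma partial_ext_transfinite:
  fixes P K :: "('i \<Rightarrow> bool) set" and R :: "'j rel"
  assumes wf: "wf R" and trans: "trans R" and total: "total_on T R"
    and step: "\<And>i \<phi> \<psi>. i \<in> T \<Longrightarrow> partial_ext P K f g (\<Union>j\<in>{j\<in>T. (j,i) \<in> R}. M j) \<phi> \<psi> \<Longrightarrow>
      \<exists>\<phi>' \<psi>'. partial_ext P K f g ((\<Union>j\<in>{j\<in>T. (j,i) \<in> R}. M j) \<union> M i) \<phi>' \<psi>' \<and>
        (\<forall>x. agree (\<Union>j\<in>{j\<in>T. (j,i) \<in> R}. M j) (\<phi>' x) (\<phi> x) \<and>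
             agree (\<Union>j\<in>{j\<in>T. (j,i) \<in> R}. M j) (\<psi>' x) (\<psi> x))"
  shows "\<exists>\<phi> \<psi>. partial_ext P K f g (\<Union>j\<in>T. M j) \<phi> \<psi>"
proof -
  define L where "L i = {j\<in>T. (j,i) \<in> R}" for i
  define U where "U i = (\<Union>j\<in>L i. M j) \<union> M i" for i
  have U_mono: "U j \<subseteq> U i" if "(j,i) \<in> R" "j \<in> T" for i j
  proof -
    have "L j \<subseteq> L i" using that trans unfolding L_def trans_def by auto
    then show ?thesis using that by (auto simp: U_def L_def)
  qed
  have U_L: "(\<Union>j\<in>L i. U j) = (\<Union>j\<in>L i. M j)" for i
  proof -
    have "L j \<subseteq> L i" if "j \<in> L i" for j using that trans unfolding L_def trans_def by auto
    then show ?thesis by (auto simp: U_def)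
  qed
  have U_T: "(\<Union>j\<in>T. U j) = (\<Union>j\<in>T. M j)" by (auto simp: U_def L_def)
  define Q where "Q s i r \<longleftrightarrow> (i \<in> T \<longrightarrow> partial_ext P K f g (U i) (fst r) (snd r) \<and>
      (\<forall>j\<in>L i. \<forall>x. agree (U j) (fst (s j) x) (fst r x) \<and> agree (U j) (snd (s j) x) (snd r x)))"
    for s i and r :: "(('i \<Rightarrow> bool) \<Rightarrow> 'i \<Rightarrow> bool) \<times> (('i \<Rightarrow> bool) \<Rightarrow> 'i \<Rightarrow> bool)"
  \<comment> \<open>Stated for arbitrary \<open>I\<close>, since it serves twice: for the
    predecessors of a stage and, at the end, for all of \<open>T\<close>.\<close>
  have merge: "\<exists>\<Phi> \<Psi>. partial_ext P K f g (\<Union>j\<in>I. U j) \<Phi> \<Psi> \<and>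
      (\<forall>j\<in>I. \<forall>x. agree (U j) (fst (s j) x) (\<Phi> x) \<and> agree (U j) (snd (s j) x) (\<Psi> x))"
    if I: "I \<subseteq> T" and Q: "\<And>j. j \<in> I \<Longrightarrow> Q s j (s j)" for I s
  proof (rule partial_ext_directed_union)
    show "partial_ext P K f g (U j) (fst (s j)) (snd (s j))" if "j \<in> I" for j
      using Q[OF that] that I unfolding Q_def by auto
    show "U j \<subseteq> U k \<or> U k \<subseteq> U j" if "j \<in> I" "k \<in> I" for j k
      using total that I U_mono unfolding total_on_def by (metis order_refl subsetD)
    show "agree (U j) (fst (s j) x) (fst (s k) x) \<and> agree (U j) (snd (s j) x) (snd (s k) x)"
      if jk: "j \<in> I" "k \<in> I" and sub: "U j \<subseteq> U k" for j k x
    proof -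
      consider "j = k" | "(j,k) \<in> R" | "(k,j) \<in> R"
        using total jk I unfolding total_on_def by auto
      then show ?thesis
      proof cases
        case 1 then show ?thesis by simp
      next
        case 2
        then show ?thesis using Q[OF jk(2)] jk I unfolding Q_def L_def by auto
      next
        case 3
        then have eq: "U j = U k" using U_mono sub jk I by auto
        have "agree (U k) (fst (s k) x) (fst (s j) x) \<and> agree (U k) (snd (s k) x) (snd (s j) x)"
          using 3 Q[OF jk(1)] jk I unfolding Q_def L_def by auto
        then show ?thesis unfolding eq using agree_sym by metis
      qed
    qed
  qed
  have "\<exists>s. \<forall>i. Q s i (s i)"
  proof (rule dependent_wf_choice[OF wf])
    fix s s' :: "'j \<Rightarrow> (('i \<Rightarrow> bool) \<Rightarrow> 'i \<Rightarrow> bool) \<times> (('i \<Rightarrow> bool) \<Rightarrow> 'i \<Rightarrow> bool)"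
    fix i r
    assume "\<And>z. (z, i) \<in> R \<Longrightarrow> s z = s' z"
    then have "s j = s' j" if "j \<in> L i" for j using that by (simp add: L_def)
    then show "Q s i r = Q s' i r" unfolding Q_def by simp
  next
    fix i s assume Q: "\<And>j. (j, i) \<in> R \<Longrightarrow> Q s j (s j)"
    show "\<exists>r. Q s i r"
    proof (cases "i \<in> T")
      case True
      have "\<exists>\<Phi> \<Psi>. partial_ext P K f g (\<Union>j\<in>L i. U j) \<Phi> \<Psi> \<and>
        (\<forall>j\<in>L i. \<forall>x. agree (U j) (fst (s j) x) (\<Phi> x) \<and> agree (U j) (snd (s j) x) (\<Psi> x))"
        by (rule merge) (use Q in \<open>auto simp: L_def\<close>)
      then obtain \<Phi> \<Psi> where 1: "partial_ext P K f g (\<Union>j\<in>L i. M j) \<Phi> \<Psi>"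
        "\<And>j x. j \<in> L i \<Longrightarrow> agree (U j) (fst (s j) x) (\<Phi> x) \<and> agree (U j) (snd (s j) x) (\<Psi> x)"
        unfolding U_L by auto
      obtain \<phi>' \<psi>' where 2: "partial_ext P K f g (U i) \<phi>' \<psi>'"
        "\<And>x. agree (\<Union>j\<in>L i. M j) (\<phi>' x) (\<Phi> x) \<and> agree (\<Union>j\<in>L i. M j) (\<psi>' x) (\<Psi> x)"
        using step[OF True, of \<Phi> \<Psi>] 1(1) unfolding L_def U_def by auto
      have "agree (U j) (fst (s j) x) (\<phi>' x) \<and> agree (U j) (snd (s j) x) (\<psi>' x)" if j: "j \<in> L i" for j x
      proof -
        have "U j \<subseteq> (\<Union>j\<in>L i. M j)" using U_L j by auto
        then have "agree (U j) (\<phi>' x) (\<Phi> x)" "agree (U j) (\<psi>' x) (\<Psi> x)"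
          using 2(2)[of x] agree_mono by auto
        then show ?thesis using 1(2)[OF j, of x] by (meson agree_sym agree_trans)
      qed
      then have "Q s i (\<phi>', \<psi>')" using 2(1) unfolding Q_def by simp
      then show ?thesis ..
    qed (simp add: Q_def)
  qed
  then obtain s where "\<And>i. Q s i (s i)" by auto
  then show ?thesis using merge[of T s] unfolding U_T by auto
qed

subsection \<open>Consequences of compactness\<close>

text \<open>Compactness of the full power of the two-point space, phrased with finitely many centres
  that carry their own supports.\<close>

lemma finite_cylinder_cover:
  fixes E :: "('i \<Rightarrow> bool) \<Rightarrow> 'i set"
  assumes fin: "\<And>x. finite (E x)"
  shows "\<exists>Y. finite Y \<and> (\<forall>x. \<exists>y\<in>Y. agree (E y) x y)"
proof -
  let ?X = "product_topology (\<lambda>_. discrete_topology (UNIV :: bool set)) (UNIV :: 'i set)"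
  define V where "V y = {x. agree (E y) x y}" for y
  have openV: "openin ?X (V y)" for y
  proof -
    have "V y = PiE UNIV (\<lambda>i. if i \<in> E y then {y i} else UNIV)"
      by (auto simp: V_def agree_def PiE_iff split: if_splits)
    moreover have "finite {i. (if i \<in> E y then {y i} else UNIV) \<noteq> (UNIV :: bool set)}"
      by (rule finite_subset[OF _ fin[of y]]) (auto split: if_splits)
    ultimately show ?thesis by (auto intro!: product_topology_basis)
  qed
  have "compact_space ?X"
    by (simp add: compact_space_product_topology compact_space_discrete_topology)
  moreover have "\<forall>U\<in>range V. openin ?X U" using openV by simp
  moreover have "topspace ?X \<subseteq> \<Union>(range V)" by (auto simp: V_def)
  ultimately have "\<exists>F. finite F \<and> F \<subseteq> range V \<and> topspace ?X \<subseteq> \<Union>F"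
    unfolding compact_space_alt by simp
  then obtain F where F: "finite F" "F \<subseteq> range V" "UNIV \<subseteq> \<Union>F"
    by auto
  then obtain Y where Y: "finite Y" "F = V ` Y" by (meson finite_subset_image)
  then have "\<exists>y\<in>Y. agree (E y) x y" for x
    using F(3) by (auto simp: V_def)
  then show ?thesis using Y(1) by blast
qed

text \<open>For a set of total functions this means closed in the product topology and independent
  of the coordinates outside \<open>T\<close>.\<close>

definition cylinder_closed :: "'i set \<Rightarrow> ('i \<Rightarrow> bool) set \<Rightarrow> bool" where
  "cylinder_closed T P \<longleftrightarrow>
     (\<forall>x. x \<notin> P \<longrightarrow> (\<exists>E. finite E \<and> E \<subseteq> T \<and> (\<forall>y. agree E y x \<longrightarrow> y \<notin> P)))"

text \<open>Points outside \<open>P\<close> receive a cylinder that misses \<open>P\<close>, where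
  the condition is vacuous. The whole space is then covered, and the union of finitely many supports
  is a uniform one.\<close>

lemma fin_dep_of_local:
  assumes closed: "cylinder_closed T P"
    and loc: "\<And>x. x \<in> P \<Longrightarrow> \<exists>E. finite E \<and> E \<subseteq> T \<and> (\<forall>y\<in>P. agree E y x \<longrightarrow> h y = h x)"
  shows "fin_dep P T h"
proof -
  have "\<exists>E. finite E \<and> E \<subseteq> T \<and> (\<forall>y\<in>P. agree E y x \<longrightarrow> h y = h x)" for x
  proof (cases "x \<in> P")
    case False
    then obtain E where "finite E" "E \<subseteq> T" "\<forall>y. agree E y x \<longrightarrow> y \<notin> P"
      using closed unfolding cylinder_closed_def by auto
    then show ?thesis by (intro exI[of _ E]) auto
  qed (rule loc)
  then obtain E where E: "\<And>x. finite (E x)" "\<And>x. E x \<subseteq> T"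
    "\<And>x y. y \<in> P \<Longrightarrow> agree (E x) y x \<Longrightarrow> h y = h x" by metis
  obtain Y where Y: "finite Y" "\<And>x. \<exists>y\<in>Y. agree (E y) x y"
    using finite_cylinder_cover[of E] E(1) by auto
  show ?thesis
  proof (rule fin_depI)
    show "finite (\<Union>y\<in>Y. E y)" "(\<Union>y\<in>Y. E y) \<subseteq> T" using Y(1) E by auto
    fix x y assume xy: "x \<in> P" "y \<in> P" "agree (\<Union>y\<in>Y. E y) x y"
    obtain z where z: "z \<in> Y" "agree (E z) x z" using Y(2) by blast
    have "agree (E z) x y" by (rule agree_mono[OF xy(3)]) (use z in auto)
    then have "agree (E z) y z" using z(2) by (meson agree_sym agree_trans)
    then show "h x = h y" using E(3)[of x z] E(3)[of y z] xy z(2) by simp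
  qed
qed

text \<open>Each \<open>x\<close> is moved off \<open>K\<close> without changing it on
  \<open>B\<close>, to a point \<open>p x\<close> with a cylinder missing \<open>K\<close>.
  Compactness leaves finitely many of these cylinders, whose union is \<open>u\<close>.\<close>

lemma cofinal_clopen:
  assumes closed: "cylinder_closed T K" and thin: "\<And>x. \<exists>y. agree B y x \<and> y \<notin> K"
  shows "\<exists>G u. finite G \<and> G \<subseteq> T \<and> fin_dep UNIV G u \<and> (\<forall>y\<in>K. \<not> u y) \<and>
    (\<forall>y. \<exists>y'. agree B y' y \<and> u y')"
proof -
  have "\<exists>y E. agree B y x \<and> finite E \<and> E \<subseteq> T \<and> (\<forall>z. agree E z y \<longrightarrow> z \<notin> K)" for x
  proof -
    obtain y where y: "agree B y x" "y \<notin> K" using thin by auto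
    then obtain E where "finite E" "E \<subseteq> T" "\<forall>z. agree E z y \<longrightarrow> z \<notin> K"
      using closed unfolding cylinder_closed_def by auto
    with y show ?thesis by auto
  qed
  then obtain p E where E: "\<And>x. agree B (p x) x" "\<And>x. finite (E x)" "\<And>x. E x \<subseteq> T"
    "\<And>x z. agree (E x) z (p x) \<Longrightarrow> z \<notin> K" by metis
  obtain Y where Y: "finite Y" "\<And>x. \<exists>y\<in>Y. agree (B \<inter> E y) x y"
    using finite_cylinder_cover[of "\<lambda>y. B \<inter> E y"] E(2) by auto
  define u where "u w \<longleftrightarrow> (\<exists>y\<in>Y. agree (E y) w (p y))" for w
  have "fin_dep UNIV (\<Union>y\<in>Y. E y) u"
  proof (rule fin_depI)
    fix v w :: "'a \<Rightarrow> bool" assume "agree (\<Union>y\<in>Y. E y) v w"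
    then have "agree (E y) v w" if "y \<in> Y" for y by (rule agree_mono) (use that in auto)
    then show "u v = u w" unfolding u_def by (meson agree_sym agree_trans)
  qed (use Y(1) E in auto)
  moreover have "\<not> u y" if "y \<in> K" for y using E(4) that unfolding u_def by auto
  moreover have "\<exists>w'. agree B w' w \<and> u w'" for w
  proof -
    obtain y where y: "y \<in> Y" "agree (B \<inter> E y) w y" using Y(2) by auto
    \<comment> \<open>Since \<open>p y\<close> and \<open>w\<close> agree on \<open>B\<close> within
      \<open>E y\<close>, overwriting \<open>w\<close> on \<open>E y\<close> leaves it unchanged on
      \<open>B\<close>.\<close>
    define w' where "w' i = (if i \<in> E y then p y i else w i)" for i
    have "agree B w' w" using E(1)[of y] y(2) by (auto simp: w'_def agree_def)
    moreover have "agree (E y) w' (p y)" by (simp add: w'_def agree_def)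
    ultimately show ?thesis using y(1) unfolding u_def by auto
  qed
  moreover have "finite (\<Union>y\<in>Y. E y)" "(\<Union>y\<in>Y. E y) \<subseteq> T" using Y(1) E by auto
  ultimately show ?thesis by blast
qed

subsection \<open>Cardinality arguments\<close>

lemma countable_card_le: "countable A \<Longrightarrow> Cinfinite \<kappa> \<Longrightarrow> |A| \<le>o \<kappa>"
  using countable_card_le_natLeq natLeq_ordLeq_cinfinite ordLeq_transitive by metis

lemma card_finite_subsets_le:
  assumes \<kappa>: "Cinfinite \<kappa>" and A: "|A| \<le>o \<kappa>"
  shows "|{E. finite E \<and> E \<subseteq> A}| \<le>o \<kappa>"
proof -
  define S where "S n = rec_nat {{}} (\<lambda>_ S. \<Union>a\<in>A. insert a ` S) n" for n :: nat
  have S_simps: "S 0 = {{}}" "S (Suc n) = (\<Union>a\<in>A. insert a ` S n)" for n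
    by (simp_all add: S_def)
  have "|S n| \<le>o \<kappa>" for n
  proof (induction n)
    case 0
    show ?case unfolding S_simps by (rule countable_card_le[OF _ \<kappa>]) simp
  next
    case (Suc n)
    show ?case
      unfolding S_simps
      by (intro UNION_Cinfinite_bound A \<kappa> ballI ordLeq_transitive[OF card_of_image Suc])
  qed
  then have U: "|\<Union>n\<in>UNIV. S n| \<le>o \<kappa>"
    by (intro UNION_Cinfinite_bound \<kappa> countable_card_le) auto
  have "{E. finite E \<and> E \<subseteq> A} \<subseteq> (\<Union>n. S n)"
  proof safe
    fix E assume "finite E" "E \<subseteq> A"
    then have "\<exists>n. E \<in> S n"
    proof (induction E)
      case empty
      show ?case by (rule exI[of _ 0]) (simp add: S_simps)
    next
      case (insert a E)
      then obtain n where "E \<in> S n" by auto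
      then have "insert a E \<in> S (Suc n)" using insert.prems by (auto simp: S_simps)
      then show ?case by blast
    qed
    then show "E \<in> (\<Union>n. S n)" by simp
  qed
  then show ?thesis by (rule ordLeq_transitive[OF card_of_mono1 U])
qed

text \<open>Countably many closing steps suffice, because a finite subset of an increasing union
  lies in one stage and only finite arguments of \<open>H\<close> count.\<close>

lemma closed_superset_le:
  assumes \<kappa>: "Cinfinite \<kappa>" and S: "|S| \<le>o \<kappa>" "S \<subseteq> T"
    and H: "\<And>E. finite E \<Longrightarrow> E \<subseteq> T \<Longrightarrow> H E \<subseteq> T \<and> |H E| \<le>o \<kappa>"
  shows "\<exists>M. S \<subseteq> M \<and> M \<subseteq> T \<and> |M| \<le>o \<kappa> \<and> (\<forall>E. finite E \<and> E \<subseteq> M \<longrightarrow> H E \<subseteq> M)"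
proof -
  define M where "M n = rec_nat S (\<lambda>_ M. M \<union> (\<Union>E\<in>{E. finite E \<and> E \<subseteq> M}. H E)) n" for n :: nat
  have M_simps: "M 0 = S" "M (Suc n) = M n \<union> (\<Union>E\<in>{E. finite E \<and> E \<subseteq> M n}. H E)" for n
    by (simp_all add: M_def)
  have M: "M n \<subseteq> T \<and> |M n| \<le>o \<kappa>" for n
  proof (induction n)
    case 0
    then show ?case using S by (simp add: M_simps)
  next
    case (Suc n)
    have "|\<Union>E\<in>{E. finite E \<and> E \<subseteq> M n}. H E| \<le>o \<kappa>"
      using H Suc by (intro UNION_Cinfinite_bound \<kappa> card_finite_subsets_le) auto
    moreover have "(\<Union>E\<in>{E. finite E \<and> E \<subseteq> M n}. H E) \<subseteq> T" using H Suc by blast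
    ultimately show ?case
      using Suc \<kappa> unfolding M_simps
      by (auto simp: cinfinite_def intro: card_of_Un_ordLeq_infinite_Field)
  qed
  have "incseq M" by (rule incseq_SucI) (auto simp: M_simps)
  have "H E \<subseteq> (\<Union>n. M n)" if E: "finite E" "E \<subseteq> (\<Union>n. M n)" for E
  proof -
    have "\<exists>n. E \<subseteq> M n"
      using E
    proof (induction E)
      case (insert a E)
      then obtain n m where "E \<subseteq> M n" "a \<in> M m" by auto
      moreover have "M n \<subseteq> M (max n m)" "M m \<subseteq> M (max n m)"
        using \<open>incseq M\<close> by (auto simp: incseq_def)
      ultimately show ?case by blast
    qed simp
    then obtain n where "E \<subseteq> M n" by auto
    then have "H E \<subseteq> M (Suc n)" using E(1) unfolding M_simps by blast
    then show ?thesis by blast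
  qed
  moreover have "|\<Union>n. M n| \<le>o \<kappa>"
    using M by (intro UNION_Cinfinite_bound \<kappa> countable_card_le) auto
  moreover have "S \<subseteq> (\<Union>n. M n)" using M_simps(1) by blast
  moreover have "(\<Union>n. M n) \<subseteq> T" using M by blast
  ultimately show ?thesis by (intro exI[of _ "\<Union>n. M n"]) simp
qed

text \<open>
  Take \<open>C\<close> so large that every finite pattern on \<open>C\<close> realised in \<open>P\<close> is realised by some point whose
  cube inside \<open>P\<close> has its support in \<open>C\<close>. These cubes are then dense in \<open>P\<close>.
\<close>

lemma depends_on_small:
  fixes P :: "('i \<Rightarrow> bool) set"
  assumes closed: "cylinder_closed T P" and \<kappa>: "Cinfinite \<kappa>"
    and D: "\<And>x. x \<in> P \<Longrightarrow> \<exists>D\<subseteq>T. |D| \<le>o \<kappa> \<and> (\<forall>y. agree D y x \<longrightarrow> y \<in> P)"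
  shows "\<exists>C\<subseteq>T. |C| \<le>o \<kappa> \<and> depends_on P C"
proof -
  have "\<forall>x\<in>P. \<exists>D. D \<subseteq> T \<and> |D| \<le>o \<kappa> \<and> (\<forall>y. agree D y x \<longrightarrow> y \<in> P)" using D by auto
  from bchoice[OF this] obtain D where
    D: "\<And>x. x \<in> P \<Longrightarrow> D x \<subseteq> T \<and> |D x| \<le>o \<kappa> \<and> (\<forall>y. agree (D x) y x \<longrightarrow> y \<in> P)" by auto
  \<comment> \<open>A pattern on \<open>E\<close> is coded by the set \<open>s\<close> of
    coordinates with value true; \<open>pat E s\<close> is a point of \<open>P\<close> realising it,
    if there is one.\<close>
  define pat where "pat E s = (SOME x. x \<in> P \<and> (\<forall>i\<in>E. x i \<longleftrightarrow> i \<in> s))" for E s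
  have pat: "pat E s \<in> P \<and> (\<forall>i\<in>E. pat E s i \<longleftrightarrow> i \<in> s)" if "x \<in> P" "\<forall>i\<in>E. x i \<longleftrightarrow> i \<in> s" for E s x
    unfolding pat_def by (rule someI[of _ x]) (use that in simp)
  \<comment> \<open>A finite \<open>E\<close> carries finitely many patterns, so \<open>H E\<close>
    collects the supports of finitely many cubes.\<close>
  define H where "H E = (\<Union>s\<in>{s \<in> Pow E. pat E s \<in> P}. D (pat E s))" for E
  have "H E \<subseteq> T \<and> |H E| \<le>o \<kappa>" if "finite E" for E
  proof
    show "H E \<subseteq> T" using D by (auto simp: H_def)
    have "countable {s \<in> Pow E. pat E s \<in> P}" using that by (intro countable_finite) simp
    then show "|H E| \<le>o \<kappa>"
      unfolding H_def using D by (intro UNION_Cinfinite_bound \<kappa> countable_card_le) auto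
  qed
  moreover have "|{} :: 'i set| \<le>o \<kappa>" by (rule countable_card_le[OF _ \<kappa>]) simp
  ultimately obtain C where C: "C \<subseteq> T" "|C| \<le>o \<kappa>" "\<And>E. finite E \<Longrightarrow> E \<subseteq> C \<Longrightarrow> H E \<subseteq> C"
    using closed_superset_le[OF \<kappa>, of "{}" T H] by auto
  have "y \<in> P" if x: "x \<in> P" and xy: "agree C x y" for x y
  proof (rule ccontr)
    assume "y \<notin> P"
    then obtain E where E: "finite E" "\<And>z. agree E z y \<Longrightarrow> z \<notin> P"
      using closed unfolding cylinder_closed_def by auto
    define s where "s = {i \<in> E \<inter> C. x i}"
    define x' where "x' = pat (E \<inter> C) s"
    have x': "x' \<in> P" "\<forall>i\<in>E\<inter>C. x' i \<longleftrightarrow> i \<in> s"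
      using pat[OF x, of "E \<inter> C" s] by (auto simp: s_def x'_def)
    have "s \<in> {s \<in> Pow (E \<inter> C). pat (E \<inter> C) s \<in> P}"
      using x'(1) by (auto simp: x'_def s_def)
    then have "D x' \<subseteq> H (E \<inter> C)" unfolding H_def x'_def by blast
    then have sub: "D x' \<subseteq> C" using C(3)[of "E \<inter> C"] E(1) by auto
    \<comment> \<open>On \<open>E\<close> within \<open>C\<close> the points \<open>y\<close>,
      \<open>x\<close> and \<open>x'\<close> agree, and the cube of \<open>x'\<close> is restricted
      only on a part of \<open>C\<close>. Pasting \<open>y\<close> on \<open>E\<close> into
      \<open>x'\<close> thus stays in that cube, although the cylinder of \<open>y\<close> over
      \<open>E\<close> misses \<open>P\<close>.\<close>
    define z where "z i = (if i \<in> E then y i else x' i)" for i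
    have "agree (D x') z x'"
      using sub x'(2) xy by (auto simp: z_def agree_def s_def)
    then have "z \<in> P" using D[OF x'(1)] by simp
    moreover have "agree E z y" by (simp add: z_def agree_def)
    ultimately show False using E(2) by simp
  qed
  then show ?thesis using C(1,2) unfolding depends_on_def by (intro exI[of _ C]) auto
qed

lemma depends_on_mono: "depends_on P A \<Longrightarrow> A \<subseteq> B \<Longrightarrow> depends_on P B"
  unfolding depends_on_def using agree_mono by blast

section \<open>The order in which coordinates are added\<close>

text \<open>An injection into the field of \<open>\<kappa>\<close> orders \<open>C\<close>, and
  proper initial segments of a cardinal have smaller cardinality. All other coordinates come after
  \<open>C\<close>.\<close>

lemma initial_wellorder:
  fixes \<kappa> :: "'k rel" and C :: "'i set"
  assumes \<kappa>: "Card_order \<kappa>" and C: "|C| \<le>o \<kappa>"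
  shows "\<exists>R :: 'i rel. wf R \<and> trans R \<and> total R \<and> (\<forall>i\<in>C. |{j. (j,i) \<in> R}| <o \<kappa>) \<and>
    (\<forall>i\<in>C. \<forall>j. j \<notin> C \<longrightarrow> (i,j) \<in> R)"
proof -
  have "|C| \<le>o |Field \<kappa>|" using C card_of_Field_ordIso[OF \<kappa>] ordLeq_ordIso_trans ordIso_symmetric by blast
  then obtain h where h: "inj_on h C" "h ` C \<subseteq> Field \<kappa>" using card_of_ordLeq[of C "Field \<kappa>"] by auto
  obtain W :: "'i rel" where W: "Well_order W" "Field W = UNIV"
    using well_ordering[where 'a = 'i] by (elim exE conjE) (rule that)
  have wo: "Well_order \<kappa>" using \<kappa> by (simp add: card_order_on_def)
  \<comment> \<open>The first entry puts \<open>C\<close> in front. Outside \<open>C\<close> the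
    second entry is constant, so the well-order \<open>W\<close> on the last entry decides
    there.\<close>
  define key where "key i = (if i \<in> C then (0::nat, h i, i) else (1, undefined, i))" for i
  define R where "R = inv_image (less_than <*lex*> (\<kappa> - Id) <*lex*> (W - Id)) key"
  have wfs: "wf (\<kappa> - Id)" "wf (W - Id)" using wo W by (auto simp: well_order_on_def)
  have trs: "trans (\<kappa> - Id)" "trans (W - Id)"
    using wo W(1) by (auto simp: order_on_defs intro!: trans_diff_Id)
  have "wf R" unfolding R_def using wfs by (intro wf_inv_image wf_lex_prod) auto
  moreover have "trans R" unfolding R_def using trs by (intro trans_inv_image trans_lex_prod) auto
  moreover have "total R"
  proof (rule total_onI)
    fix i j :: 'i assume ij: "i \<noteq> j"
    have W': "(i,j) \<in> W \<or> (j,i) \<in> W" using W ij unfolding order_on_defs total_on_def by blast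
    have \<kappa>': "(h i, h j) \<in> \<kappa> - Id \<or> (h j, h i) \<in> \<kappa> - Id" if "i \<in> C" "j \<in> C"
    proof -
      have "h i \<noteq> h j" using h(1) that ij by (auto simp: inj_on_def)
      moreover have "h i \<in> Field \<kappa>" "h j \<in> Field \<kappa>" using h(2) that by auto
      moreover have "Total \<kappa>" using wo by (auto simp: order_on_defs)
      ultimately show ?thesis unfolding total_on_def by auto
    qed
    show "(i,j) \<in> R \<or> (j,i) \<in> R"
      using W' \<kappa>' ij unfolding R_def key_def by auto
  qed
  moreover have "|{j. (j,i) \<in> R}| <o \<kappa>" if i: "i \<in> C" for i
  proof -
    have sub: "{j. (j,i) \<in> R} \<subseteq> C" using i unfolding R_def key_def by (auto split: if_splits)
    have "(h j, h i) \<in> \<kappa> \<and> h j \<noteq> h i" if "(j,i) \<in> R" for j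
    proof -
      have j: "j \<in> C" using sub that by auto
      have "(h j, h i) \<in> \<kappa> - Id \<or> h j = h i \<and> (j, i) \<in> W - Id"
        using that i j unfolding R_def key_def by auto
      then show ?thesis using h(1) i j by (auto simp: inj_on_def)
    qed
    then have "h ` {j. (j,i) \<in> R} \<subseteq> underS \<kappa> (h i)" by (auto simp: underS_def)
    then have "|{j. (j,i) \<in> R}| \<le>o |underS \<kappa> (h i)|"
      using sub h(1) card_of_ordLeq[of "{j. (j,i) \<in> R}" "underS \<kappa> (h i)"] by (meson inj_on_subset)
    moreover have "|underS \<kappa> (h i)| <o \<kappa>" using card_of_underS[OF \<kappa>] h(2) i by auto
    ultimately show ?thesis by (rule ordLeq_ordLess_trans)
  qed
  moreover have "(i,j) \<in> R" if "i \<in> C" "j \<notin> C" for i j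
    using that unfolding R_def key_def by auto
  ultimately show ?thesis by blast
qed

text \<open>If \<open>i\<close> is outside \<open>C\<close>, all of \<open>C\<close> precedes it. If
  \<open>i\<close> is in an uncountable \<open>C\<close>, then \<open>\<kappa>\<close> is
  uncountable and fewer than \<open>\<kappa>\<close> countable blocks have a union below
  \<open>\<kappa>\<close>. For countable \<open>C\<close>, where one block may already have size
  \<open>\<kappa>\<close>, every block contains all of \<open>C\<close>.\<close>

lemma small_or_contains_initial:
  fixes C :: "'i set"
  assumes \<kappa>: "Cinfinite \<kappa>" and small: "\<forall>i\<in>C. |{j. (j,i) \<in> R}| <o \<kappa>"
    and before: "\<forall>i\<in>C. \<forall>j. j \<notin> C \<longrightarrow> (i,j) \<in> R"
    and C: "C \<subseteq> T" "|C| \<le>o \<kappa>"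
    and M: "\<And>i. i \<in> T \<Longrightarrow> countable (M i) \<and> i \<in> M i \<and> (countable C \<longrightarrow> C \<subseteq> M i)"
    and i: "i \<in> T"
  shows "|\<Union>j\<in>{j\<in>T. (j,i) \<in> R}. M j| <o \<kappa> \<or> C \<subseteq> (\<Union>j\<in>{j\<in>T. (j,i) \<in> R}. M j)"
proof (cases "countable C")
  case True
  have "|{} :: 'i set| <o \<kappa>"
    by (rule finite_ordLess_infinite) (use \<kappa> in \<open>auto simp: cinfinite_def card_order_on_def card_of_well_order_on Field_card_of\<close>)
  then have "L = {} \<Longrightarrow> |\<Union>j\<in>L. M j| <o \<kappa>" for L :: "'i set" by simp
  moreover have "C \<subseteq> (\<Union>j\<in>L. M j)" if "L \<noteq> {}" "L \<subseteq> T" for L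
    using True M that by blast
  ultimately show ?thesis by (metis (no_types, lifting) mem_Collect_eq subsetI)
next
  case unc: False
  show ?thesis
  proof (cases "i \<in> C")
    case False
    then have "C \<subseteq> {j\<in>T. (j,i) \<in> R}" using before C(1) by auto
    then show ?thesis using M C(1) by auto
  next
    case True
    define L where "L = {j\<in>T. (j,i) \<in> R}"
    have "|L| \<le>o |{j. (j,i) \<in> R}|" by (rule card_of_mono1) (auto simp: L_def)
    then have L: "|L| <o \<kappa>" using small True ordLeq_ordLess_trans by blast
    have cM: "countable (M j)" if "j \<in> L" for j using M that by (auto simp: L_def)
    have "|\<Union>j\<in>L. M j| <o \<kappa>"
    proof (cases "finite L")
      case True
      then have "countable (\<Union>j\<in>L. M j)" using cM by (intro countable_UN[OF countable_finite])
      then have "|\<Union>j\<in>L. M j| \<le>o natLeq" by (simp add: countable_card_le_natLeq)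
      moreover have "natLeq <o |C|"
        using unc natLeq_Well_order card_of_Well_order not_ordLeq_iff_ordLess
        unfolding countable_card_le_natLeq by metis
      ultimately show ?thesis by (rule ordLeq_ordLess_trans[OF _ ordLess_ordLeq_trans[OF _ C(2)]])
    next
      case False
      then have cinf: "Cinfinite |L|"
        by (simp add: cinfinite_def Field_card_of card_of_card_order_on)
      have "|\<Union>j\<in>L. M j| \<le>o |L|"
        by (intro UNION_Cinfinite_bound cinf card_of_mono1 ballI countable_card_le cM order_refl)
      then show ?thesis by (rule ordLeq_ordLess_trans[OF _ L])
    qed
    then show ?thesis by (simp add: L_def)
  qed
qed

text \<open>
  Working with sets saturated for such a \<open>p\<close> ensures that every proper step adds infinitely many
  coordinates.
\<close>

lemma infinite_countable_blocks:
  assumes T: "infinite (T :: 'i set)"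
  shows "\<exists>p :: 'i \<Rightarrow> 'i. \<forall>i\<in>T. infinite {j\<in>T. p j = p i} \<and> countable {j\<in>T. p j = p i}"
proof -
  have "|UNIV :: nat set| \<le>o |T|" using T infinite_iff_card_of_nat by blast
  then have "|T| =o |T \<times> (UNIV :: nat set)|"
    using card_of_Times_infinite[OF T, of "UNIV :: nat set"] ordIso_symmetric by blast
  then obtain q where q: "bij_betw q T (T \<times> (UNIV :: nat set))"
    using card_of_ordIso by blast
  \<comment> \<open>The blocks are the copies of the natural numbers in
    \<open>T \<times> UNIV\<close>, carried back by \<open>q\<close>.\<close>
  define p where "p = fst \<circ> q"
  have im: "q ` {j\<in>T. p j = p i} = {p i} \<times> UNIV" if "i \<in> T" for i
  proof
    show "q ` {j\<in>T. p j = p i} \<subseteq> {p i} \<times> UNIV"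
    proof safe
      fix j a b assume "p j = p i" "(a, b) = q j"
      then show "a = p i" by (metis p_def comp_apply fst_conv)
    qed auto
    have "q i \<in> T \<times> UNIV" using q that by (auto simp: bij_betw_def)
    then have "p i \<in> T" by (auto simp: p_def)
    show "{p i} \<times> UNIV \<subseteq> q ` {j\<in>T. p j = p i}"
    proof safe
      fix n :: nat
      have "(p i, n) \<in> q ` T" using q \<open>p i \<in> T\<close> by (auto simp: bij_betw_def)
      then obtain j where "j \<in> T" "q j = (p i, n)" by auto
      then show "(p i, n) \<in> q ` {j\<in>T. p j = p i}"
        by (intro image_eqI[of _ _ j]) (simp_all add: p_def)
    qed
  qed
  have inj: "inj_on q {j\<in>T. p j = p i}" for i
    using q by (auto simp: bij_betw_def inj_on_def)
  show ?thesis
  proof (intro exI[of _ p] ballI conjI)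
    fix i assume i: "i \<in> T"
    have "infinite ({p i} \<times> (UNIV :: nat set))" by (simp add: finite_cartesian_product_iff)
    then show "infinite {j\<in>T. p j = p i}" using im[OF i] by (metis finite_imageI)
    show "countable {j\<in>T. p j = p i}"
      by (rule countable_image_inj_on[OF _ inj[of i]]) (simp add: im[OF i])
  qed
qed

section \<open>Countable admissible sets of coordinates\<close>

text \<open>The finite supports become an operator on coordinates; a set closed under it inherits
  finite dependence.\<close>

lemma fin_dep_witness:
  assumes "\<forall>i\<in>T. fin_dep S T (h i)"
  shows "\<exists>G. \<forall>i\<in>T. finite (G i) \<and> G i \<subseteq> T \<and> (\<forall>r. G i \<subseteq> r \<longrightarrow> fin_dep S r (h i))"
proof -
  have "\<forall>i\<in>T. \<exists>E. finite E \<and> E \<subseteq> T \<and> (\<forall>r. E \<subseteq> r \<longrightarrow> fin_dep S r (h i))"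
  proof
    fix i assume "i \<in> T"
    then have "fin_dep S T (h i)" using assms by simp
    then obtain E where E: "finite E" "E \<subseteq> T" "\<forall>x\<in>S. \<forall>y\<in>S. agree E x y \<longrightarrow> h i x = h i y"
      unfolding fin_dep_def by auto
    have "fin_dep S r (h i)" if "E \<subseteq> r" for r
      using E(1) that E(3)[rule_format] by (rule fin_depI)
    then show "\<exists>E. finite E \<and> E \<subseteq> T \<and> (\<forall>r. E \<subseteq> r \<longrightarrow> fin_dep S r (h i))"
      using E(1,2) by (intro exI[of _ E]) simp
  qed
  then show ?thesis by (rule bchoice)
qed

text \<open>The pointwise counterpart of \<open>fibre_negligible\<close>; compactness turns it into
  the uniform form.\<close>

definition thin_over where
  "thin_over T A K \<longleftrightarrow> (\<forall>E. finite E \<and> E \<subseteq> T \<longrightarrow> (\<forall>x. \<exists>y. agree (A \<union> E) y x \<and> y \<notin> K))"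

text \<open>Under thinness, \<open>G E\<close> supports a clopen set that misses \<open>K\<close>
  and is cofinal over \<open>A \<union> E\<close>. A set \<open>r\<close> closed under
  \<open>G\<close> therefore contains the supports of all clopen sets that fibre negligibility asks
  for.\<close>

lemma fibre_negligible_witness:
  assumes closed: "cylinder_closed T K"
  shows "\<exists>G. (\<forall>E. finite (G E) \<and> G E \<subseteq> T) \<and>
    (\<forall>r. thin_over T A K \<and> r \<subseteq> T \<and> (\<forall>E. finite E \<and> E \<subseteq> r \<longrightarrow> G E \<subseteq> r) \<longrightarrow>
      fibre_negligible A (A \<union> r) K)"
proof -
  define W where "W E G u \<longleftrightarrow> fin_dep UNIV G u \<and> (\<forall>y\<in>K. \<not> u y) \<and> (\<forall>y. \<exists>y'. agree (A \<union> E) y' y \<and> u y')"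
    for E G u
  have "\<exists>G. finite G \<and> G \<subseteq> T \<and> (thin_over T A K \<and> finite E \<and> E \<subseteq> T \<longrightarrow> (\<exists>u. W E G u))" for E
  proof (cases "thin_over T A K \<and> finite E \<and> E \<subseteq> T")
    case True
    then have "\<exists>y. agree (A \<union> E) y x \<and> y \<notin> K" for x
      unfolding thin_over_def by simp
    from cofinal_clopen[OF closed this] show ?thesis
      unfolding W_def by (elim exE) (rule exI, auto)
  next
    case False
    then show ?thesis by (intro exI[of _ "{}"]) auto
  qed
  then have "\<forall>E. \<exists>G. finite G \<and> G \<subseteq> T \<and> (thin_over T A K \<and> finite E \<and> E \<subseteq> T \<longrightarrow> (\<exists>u. W E G u))"
    by simp
  from choice[OF this] obtain G where G: "\<forall>E. finite (G E) \<and> G E \<subseteq> T \<and>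
      (thin_over T A K \<and> finite E \<and> E \<subseteq> T \<longrightarrow> (\<exists>u. W E (G E) u))" ..
  have "fibre_negligible A (A \<union> r) K"
    if thin: "thin_over T A K" and r: "r \<subseteq> T" and Gr: "\<And>E. finite E \<Longrightarrow> E \<subseteq> r \<Longrightarrow> G E \<subseteq> r" for r
    unfolding fibre_negligible_def
  proof (intro allI impI)
    fix E assume E: "finite E \<and> E \<subseteq> A \<union> r"
    \<comment> \<open>Coordinates of \<open>E\<close> in \<open>A\<close> are fixed anyway, so
      \<open>G\<close> is applied to \<open>E - A\<close>, which lies in \<open>r\<close>.\<close>
    then have E': "finite (E - A)" "E - A \<subseteq> r" "E - A \<subseteq> T" using r by auto
    then obtain u where u: "W (E - A) (G (E - A)) u" using G thin by auto
    have "fin_dep UNIV (A \<union> r) u"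
      using u Gr[OF E'(1,2)] unfolding W_def by (elim conjE) (erule fin_dep_mono, auto)
    moreover have "\<forall>y. \<exists>y'. agree (A \<union> E) y' y \<and> u y'"
      using u unfolding W_def by simp
    ultimately show "\<exists>u. fin_dep UNIV (A \<union> r) u \<and> (\<forall>y\<in>K. \<not> u y) \<and> (\<forall>y. \<exists>y'. agree (A \<union> E) y' y \<and> u y')"
      using u unfolding W_def by (intro exI[of _ u]) simp
  qed
  then show ?thesis using G by (intro exI[of _ G]) simp
qed

text \<open>All requirements are finitary closure conditions with countable values: classes of
  \<open>p\<close>, supports of \<open>f\<close> and \<open>g\<close>, supports of the clopen sets.
  The operator \<open>H\<close> joins them, and a countable set closed under \<open>H\<close>
  satisfies all at once.\<close>

lemma admissible_superset:
  fixes P K :: "('i \<Rightarrow> bool) set"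
  assumes closed: "cylinder_closed T P" "cylinder_closed T K"
    and f: "\<forall>i\<in>T. fin_dep P T (\<lambda>x. f x i)"
    and g: "\<forall>i\<in>T. fin_dep K T (\<lambda>y. g y i)"
    and p: "\<And>i. i \<in> T \<Longrightarrow> countable {j\<in>T. p j = p i}"
    and S: "countable S" "S \<subseteq> T"
  shows "\<exists>r. countable r \<and> S \<subseteq> r \<and> r \<subseteq> T \<and> (\<forall>i\<in>r. {j\<in>T. p j = p i} \<subseteq> r) \<and>
    (\<forall>i\<in>r. fin_dep P r (\<lambda>x. f x i) \<and> fin_dep K r (\<lambda>y. g y i)) \<and>
    (thin_over T A P \<longrightarrow> fibre_negligible A (A \<union> r) P) \<and>
    (thin_over T A K \<longrightarrow> fibre_negligible A (A \<union> r) K)"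
proof -
  from fin_dep_witness[of T P "\<lambda>i x. f x i", OF f] obtain F where
    F: "\<forall>i\<in>T. finite (F i) \<and> F i \<subseteq> T \<and> (\<forall>r. F i \<subseteq> r \<longrightarrow> fin_dep P r (\<lambda>x. f x i))"
    ..
  from fin_dep_witness[of T K "\<lambda>i y. g y i", OF g] obtain G where
    G: "\<forall>i\<in>T. finite (G i) \<and> G i \<subseteq> T \<and> (\<forall>r. G i \<subseteq> r \<longrightarrow> fin_dep K r (\<lambda>y. g y i))"
    ..
  from fibre_negligible_witness[OF closed(1), of A] obtain VP where
    "(\<forall>E. finite (VP E) \<and> VP E \<subseteq> T) \<and> (\<forall>r. thin_over T A P \<and> r \<subseteq> T \<and>
      (\<forall>E. finite E \<and> E \<subseteq> r \<longrightarrow> VP E \<subseteq> r) \<longrightarrow> fibre_negligible A (A \<union> r) P)"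
    ..
  note VP = conjunct1[OF this] conjunct2[OF this]
  from fibre_negligible_witness[OF closed(2), of A] obtain VK where
    "(\<forall>E. finite (VK E) \<and> VK E \<subseteq> T) \<and> (\<forall>r. thin_over T A K \<and> r \<subseteq> T \<and>
      (\<forall>E. finite E \<and> E \<subseteq> r \<longrightarrow> VK E \<subseteq> r) \<longrightarrow> fibre_negligible A (A \<union> r) K)"
    ..
  note VK = conjunct1[OF this] conjunct2[OF this]
  define H where "H E = (\<Union>i\<in>E. {j\<in>T. p j = p i} \<union> F i \<union> G i) \<union> (VP E \<union> VK E)" for E
  have H: "H E \<subseteq> T \<and> |H E| \<le>o natLeq" if E: "finite E" "E \<subseteq> T" for E
  proof
    have "{j\<in>T. p j = p i} \<union> F i \<union> G i \<subseteq> T" if "i \<in> E" for i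
    proof -
      have "i \<in> T" using that E by auto
      then show ?thesis using F G by auto
    qed
    then show "H E \<subseteq> T" unfolding H_def using VP(1) VK(1) by (intro Un_least UN_least) auto
    have "countable (\<Union>i\<in>E. {j\<in>T. p j = p i} \<union> F i \<union> G i)"
    proof (rule countable_UN)
      show "countable E" using E(1) by (rule countable_finite)
      fix i assume "i \<in> E"
      then have i: "i \<in> T" using E by auto
      then have "countable (F i)" "countable (G i)" using F G by (auto intro: countable_finite)
      then show "countable ({j\<in>T. p j = p i} \<union> F i \<union> G i)" using p[OF i] by simp
    qed
    moreover have "countable (VP E \<union> VK E)" using VP(1) VK(1) by (simp add: countable_finite)
    ultimately show "|H E| \<le>o natLeq"
      unfolding H_def countable_card_le_natLeq[symmetric] by (rule countable_Un)
  qed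
  have "|S| \<le>o natLeq" using S(1) by (simp add: countable_card_le_natLeq)
  from closed_superset_le[OF natLeq_Cinfinite this S(2), of H, OF H]
  obtain r where r: "S \<subseteq> r" "r \<subseteq> T" "|r| \<le>o natLeq" and Hr: "\<And>E. finite E \<Longrightarrow> E \<subseteq> r \<Longrightarrow> H E \<subseteq> r"
    by auto
  have sub: "{j\<in>T. p j = p i} \<subseteq> r" "F i \<subseteq> r" "G i \<subseteq> r" if "i \<in> r" for i
    using Hr[of "{i}"] that by (auto simp: H_def)
  have V: "VP E \<subseteq> r" "VK E \<subseteq> r" if "finite E" "E \<subseteq> r" for E
    using Hr[OF that] by (auto simp: H_def)
  have "fin_dep P r (\<lambda>x. f x i) \<and> fin_dep K r (\<lambda>y. g y i)" if "i \<in> r" for i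
  proof -
    have "i \<in> T" using that r by auto
    then show ?thesis using F G sub(2,3)[OF that] by simp
  qed
  moreover have "thin_over T A P \<longrightarrow> fibre_negligible A (A \<union> r) P"
    using VP(2) r(2) V(1) by simp
  moreover have "thin_over T A K \<longrightarrow> fibre_negligible A (A \<union> r) K"
    using VK(2) r(2) V(2) by simp
  moreover have "countable r" using r(3) by (simp add: countable_card_le_natLeq)
  ultimately show ?thesis using r(1,2) sub(1) by (intro exI[of _ r]) simp
qed

section \<open>Assembly of the extension\<close>

lemma cylinder_closed_extension:
  fixes \<kappa> :: "'k rel" and P K :: "('i \<Rightarrow> bool) set"
  assumes T: "infinite T" and \<kappa>: "Cinfinite \<kappa>"
    and inv: "inverse_on P K f g"
    and closed: "cylinder_closed T P" "cylinder_closed T K"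
    and f: "\<forall>i\<in>T. fin_dep P T (\<lambda>x. f x i)"
    and g: "\<forall>i\<in>T. fin_dep K T (\<lambda>y. g y i)"
    and dep: "\<And>x. x \<in> P \<Longrightarrow> \<exists>D\<subseteq>T. |D| \<le>o \<kappa> \<and> (\<forall>y. agree D y x \<longrightarrow> y \<in> P)"
      "\<And>x. x \<in> K \<Longrightarrow> \<exists>D\<subseteq>T. |D| \<le>o \<kappa> \<and> (\<forall>y. agree D y x \<longrightarrow> y \<in> K)"
    and thin: "\<And>B x. B \<subseteq> T \<Longrightarrow> |B| <o \<kappa> \<Longrightarrow> \<exists>y. agree B y x \<and> y \<notin> P"
      "\<And>B x. B \<subseteq> T \<Longrightarrow> |B| <o \<kappa> \<Longrightarrow> \<exists>y. agree B y x \<and> y \<notin> K"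
  shows "\<exists>\<phi> \<psi>. partial_ext P K f g T \<phi> \<psi>"
proof -
  obtain CP where CP: "CP \<subseteq> T" "|CP| \<le>o \<kappa>" "depends_on P CP"
    using depends_on_small[OF closed(1) \<kappa> dep(1)] by auto
  obtain CK where CK: "CK \<subseteq> T" "|CK| \<le>o \<kappa>" "depends_on K CK"
    using depends_on_small[OF closed(2) \<kappa> dep(2)] by auto
  define C where "C = CP \<union> CK"
  have C: "C \<subseteq> T" "|C| \<le>o \<kappa>"
    using CP CK \<kappa> by (auto simp: C_def cinfinite_def intro: card_of_Un_ordLeq_infinite_Field)
  have C_dep: "depends_on P A \<and> depends_on K A" if "C \<subseteq> A" for A
    using depends_on_mono[OF CP(3), of A] depends_on_mono[OF CK(3), of A] that by (simp add: C_def)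
  have thin_over: "thin_over T A P \<and> thin_over T A K" if A: "A \<subseteq> T" "|A| <o \<kappa>" for A
  proof -
    have bd: "A \<union> E \<subseteq> T \<and> |A \<union> E| <o \<kappa>" if "finite E" "E \<subseteq> T" for E
    proof
      have "|E| <o \<kappa>"
        using that \<kappa> by (intro finite_ordLess_infinite)
          (auto simp: cinfinite_def card_order_on_def card_of_well_order_on Field_card_of)
      then show "|A \<union> E| <o \<kappa>"
        using A(2) \<kappa> by (intro card_of_Un_ordLess_infinite_Field) (auto simp: cinfinite_def)
    qed (use A that in auto)
    show ?thesis
      unfolding thin_over_def
    proof (intro conjI allI impI)
      fix E x assume "finite E \<and> E \<subseteq> T"
      then have "A \<union> E \<subseteq> T" "|A \<union> E| <o \<kappa>" using bd[of E] by blast+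
      then show "\<exists>y. agree (A \<union> E) y x \<and> y \<notin> P" "\<exists>y. agree (A \<union> E) y x \<and> y \<notin> K"
        by (rule thin)+
    qed
  qed
  obtain p :: "'i \<Rightarrow> 'i" where "\<forall>i\<in>T. infinite {j\<in>T. p j = p i} \<and> countable {j\<in>T. p j = p i}"
    using infinite_countable_blocks[OF T] ..
  then have p: "\<And>i. i \<in> T \<Longrightarrow> infinite {j\<in>T. p j = p i}"
    "\<And>i. i \<in> T \<Longrightarrow> countable {j\<in>T. p j = p i}" by simp_all
  have "Card_order \<kappa>" using \<kappa> by simp
  from initial_wellorder[OF this C(2)] obtain R :: "'i rel" where
    R: "wf R" "trans R" "total R" "\<forall>i\<in>C. |{j. (j,i) \<in> R}| <o \<kappa>"
      "\<forall>i\<in>C. \<forall>j. j \<notin> C \<longrightarrow> (i,j) \<in> R"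
    by auto
  define L where "L i = {j\<in>T. (j,i) \<in> R}" for i
  \<comment> \<open>The block of \<open>i\<close> is chosen by recursion, since fibre negligibility
    refers to the union of the earlier blocks as base. A countable \<open>C\<close> goes into every
    block, so that each base is small or contains \<open>C\<close>.\<close>
  define Q where "Q M i r \<longleftrightarrow> (i \<in> T \<longrightarrow> countable r \<and>
    ({i} \<union> (if countable C then C else {})) \<subseteq> r \<and> r \<subseteq> T \<and> (\<forall>i\<in>r. {j\<in>T. p j = p i} \<subseteq> r) \<and>
    (\<forall>i\<in>r. fin_dep P r (\<lambda>x. f x i) \<and> fin_dep K r (\<lambda>y. g y i)) \<and>
    (thin_over T (\<Union>(M ` L i)) P \<longrightarrow> fibre_negligible (\<Union>(M ` L i)) (\<Union>(M ` L i) \<union> r) P) \<and>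
    (thin_over T (\<Union>(M ` L i)) K \<longrightarrow> fibre_negligible (\<Union>(M ` L i)) (\<Union>(M ` L i) \<union> r) K))"
    for M :: "'i \<Rightarrow> 'i set" and i r
  have "\<exists>M. \<forall>i. Q M i (M i)"
  proof (rule dependent_wf_choice[OF R(1)])
    fix M M' :: "'i \<Rightarrow> 'i set" and i r
    assume "\<And>z. (z, i) \<in> R \<Longrightarrow> M z = M' z"
    then have "M ` L i = M' ` L i" by (intro image_cong) (auto simp: L_def)
    then show "Q M i r = Q M' i r" unfolding Q_def by simp
  next
    fix i and M :: "'i \<Rightarrow> 'i set"
    show "\<exists>r. Q M i r"
    proof (cases "i \<in> T")
      case True
      show ?thesis
        unfolding Q_def using True C(1)
        by (simp only: True simp_thms, intro admissible_superset[OF closed f g p(2)]) auto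
    qed (simp add: Q_def)
  qed
  then obtain M where Q: "\<And>i. Q M i (M i)" by auto
  have M: "countable (M i)" "i \<in> M i" "countable C \<longrightarrow> C \<subseteq> M i" "M i \<subseteq> T"
    "\<forall>k\<in>M i. {j\<in>T. p j = p k} \<subseteq> M i"
    "\<forall>k\<in>M i. fin_dep P (M i) (\<lambda>x. f x k) \<and> fin_dep K (M i) (\<lambda>y. g y k)"
    "thin_over T (\<Union>(M ` L i)) P \<longrightarrow> fibre_negligible (\<Union>(M ` L i)) (\<Union>(M ` L i) \<union> M i) P"
    "thin_over T (\<Union>(M ` L i)) K \<longrightarrow> fibre_negligible (\<Union>(M ` L i)) (\<Union>(M ` L i) \<union> M i) K"
    if "i \<in> T" for i
    using Q[of i] that unfolding Q_def by (simp_all split: if_splits)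
  have step: "\<exists>\<phi>' \<psi>'. partial_ext P K f g (\<Union>(M ` L i) \<union> M i) \<phi>' \<psi>' \<and>
        (\<forall>x. agree (\<Union>(M ` L i)) (\<phi>' x) (\<phi> x) \<and> agree (\<Union>(M ` L i)) (\<psi>' x) (\<psi> x))"
    if i: "i \<in> T" and ext: "partial_ext P K f g (\<Union>(M ` L i)) \<phi> \<psi>" for i \<phi> \<psi>
  proof -
    define A where "A = \<Union>(M ` L i)"
    have AT: "A \<subseteq> T" using M(4) by (auto simp: A_def L_def)
    show ?thesis
      unfolding A_def[symmetric]
    proof (cases "M i \<subseteq> A")
      case True
      then have "A \<union> M i = A" by auto
      then show "\<exists>\<phi>' \<psi>'. partial_ext P K f g (A \<union> M i) \<phi>' \<psi>' \<and>
        (\<forall>x. agree A (\<phi>' x) (\<phi> x) \<and> agree A (\<psi>' x) (\<psi> x))"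
        using ext unfolding A_def[symmetric] by (intro exI[of _ \<phi>] exI[of _ \<psi>]) simp
    next
      case False
      then obtain k where k: "k \<in> M i" "k \<notin> A" by auto
      then have kT: "k \<in> T" using M(4)[OF i] by auto
      \<comment> \<open>All blocks are saturated for \<open>p\<close>, so a single new coordinate
        \<open>k\<close> brings its whole infinite class, none of which lies in
        \<open>A\<close>.\<close>
      have "{j\<in>T. p j = p k} \<subseteq> (A \<union> M i) - A"
      proof
        fix j assume j: "j \<in> {j\<in>T. p j = p k}"
        have "j \<notin> A"
        proof
          assume "j \<in> A"
          then obtain l where l: "l \<in> T" "l \<in> L i" "j \<in> M l" by (auto simp: A_def L_def)
          have "k \<in> {k\<in>T. p k = p j}" using j kT by simp
          then have "k \<in> M l" using M(5)[OF l(1)] l(3) by blast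
          then show False using k(2) l(2) by (auto simp: A_def)
        qed
        moreover have "j \<in> M i" using M(5)[OF i] k(1) j by blast
        ultimately show "j \<in> (A \<union> M i) - A" by simp
      qed
      then have inf: "infinite (A \<union> M i - A)" using p(1)[OF kT] finite_subset by blast
      have cnt: "countable (A \<union> M i - A)"
        using M(1)[OF i] by (rule countable_subset[rotated]) auto
      have adm: "fin_dep P (A \<union> M i) (\<lambda>x. f x k) \<and> fin_dep K (A \<union> M i) (\<lambda>x. g x k)"
        if k: "k \<in> A \<union> M i" for k
      proof -
        obtain l where l: "l \<in> T" "k \<in> M l" "M l \<subseteq> A \<union> M i"
          using k i by (auto simp: A_def L_def)
        then show ?thesis
          using M(6)[OF l(1)] by (intro conjI fin_dep_mono[OF _ l(3)]) simp_all
      qed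
      \<comment> \<open>Small bases give fibre negligibility through thinness; bases containing
        \<open>C\<close> determine both sets. These are the two cases in which a single step
        works.\<close>
      have "|A| <o \<kappa> \<or> C \<subseteq> A"
        using small_or_contains_initial[OF \<kappa> R(4,5) C _ i, of M] M(1,2,3)
        unfolding A_def L_def by simp
      then have "fibre_negligible A (A \<union> M i) P \<and> fibre_negligible A (A \<union> M i) K \<or>
          depends_on P A \<and> depends_on K A"
        using thin_over[OF AT] M(7,8)[OF i] C_dep[of A] unfolding A_def[symmetric] by auto
      from partial_ext_step[OF inv ext[folded A_def] Un_upper1 inf cnt _ _ this] adm
      show "\<exists>\<phi>' \<psi>'. partial_ext P K f g (A \<union> M i) \<phi>' \<psi>' \<and>
        (\<forall>x. agree A (\<phi>' x) (\<phi> x) \<and> agree A (\<psi>' x) (\<psi> x))"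
        by simp
    qed
  qed
  have "total_on T R" using R(3) by (rule total_on_subset) simp
  from partial_ext_transfinite[OF R(1,2) this, where M = M, of P K f g] step
  have "\<exists>\<phi> \<psi>. partial_ext P K f g (\<Union>j\<in>T. M j) \<phi> \<psi>" unfolding L_def by simp
  moreover have "(\<Union>j\<in>T. M j) = T" using M(2,4) by auto
  ultimately show ?thesis by simp
qed

subsection \<open>The Cantor cube\<close>

lemma topspace_cantor_cube: "topspace (cantor_cube \<tau>) = extensional (Field \<tau>)"
  by (auto simp: cantor_cube_def PiE_def)

lemma openin_cantor_cube_cylinder:
  assumes "finite E" "E \<subseteq> Field \<tau>"
  shows "openin (cantor_cube \<tau>) {y \<in> topspace (cantor_cube \<tau>). agree E y x}"
proof -
  have "{y \<in> topspace (cantor_cube \<tau>). agree E y x} =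
      PiE (Field \<tau>) (\<lambda>i. if i \<in> E then {x i} else UNIV)"
    using assms(2) by (auto simp: topspace_cantor_cube agree_def PiE_iff extensional_def split: if_splits)
  moreover have "finite {i. (if i \<in> E then {x i} else UNIV) \<noteq> (UNIV :: bool set)}"
    by (rule finite_subset[OF _ assms(1)]) (auto split: if_splits)
  ultimately show ?thesis
    unfolding cantor_cube_def by (auto intro!: product_topology_basis)
qed

lemma cantor_cube_open_cylinder:
  assumes U: "openin (cantor_cube \<tau>) U" and x: "x \<in> U"
  shows "\<exists>E. finite E \<and> E \<subseteq> Field \<tau> \<and> (\<forall>y\<in>topspace (cantor_cube \<tau>). agree E y x \<longrightarrow> y \<in> U)"
proof -
  obtain V where V: "finite {i \<in> Field \<tau>. V i \<noteq> (UNIV :: bool set)}"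
    "x \<in> PiE (Field \<tau>) V" "PiE (Field \<tau>) V \<subseteq> U"
    using U x unfolding cantor_cube_def openin_product_topology_alt by auto
  have "y \<in> U" if "y \<in> topspace (cantor_cube \<tau>)" "agree {i \<in> Field \<tau>. V i \<noteq> UNIV} y x" for y
  proof -
    have "y i \<in> V i" if "i \<in> Field \<tau>" for i
      using V(2) that \<open>agree _ y x\<close> by (cases "V i = UNIV") (auto simp: agree_def PiE_iff)
    then have "y \<in> PiE (Field \<tau>) V"
      using that(1) by (simp add: topspace_cantor_cube PiE_iff)
    then show ?thesis using V(3) by auto
  qed
  then show ?thesis using V(1) by (intro exI[of _ "{i \<in> Field \<tau>. V i \<noteq> UNIV}"]) auto
qed

lemma continuous_map_cantor_cube:
  assumes "\<forall>i\<in>Field \<tau>. fin_dep UNIV (Field \<tau>) (\<lambda>x. \<phi> x i)"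
  shows "continuous_map (cantor_cube \<tau>) (cantor_cube \<tau>) (\<lambda>x. restrict (\<phi> x) (Field \<tau>))"
proof -
  let ?X = "cantor_cube \<tau>"
  have "continuous_map ?X (discrete_topology UNIV) (\<lambda>x. \<phi> x i)" if i: "i \<in> Field \<tau>" for i
  proof -
    obtain E where E: "finite E" "E \<subseteq> Field \<tau>" "\<And>x y. agree E x y \<Longrightarrow> \<phi> x i = \<phi> y i"
      using assms i unfolding fin_dep_def by auto
    have "openin ?X {x \<in> topspace ?X. \<phi> x i \<in> U}" for U
    proof (subst openin_subopen, intro ballI)
      fix x assume x: "x \<in> {x \<in> topspace ?X. \<phi> x i \<in> U}"
      have "\<phi> y i \<in> U" if "agree E y x" for y
        using E(3)[OF that] x by simp
      then have "{y \<in> topspace ?X. agree E y x} \<subseteq> {x \<in> topspace ?X. \<phi> x i \<in> U}" by auto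
      then show "\<exists>V. openin ?X V \<and> x \<in> V \<and> V \<subseteq> {x \<in> topspace ?X. \<phi> x i \<in> U}"
        using openin_cantor_cube_cylinder[OF E(1,2), of x] x
        by (intro exI[of _ "{y \<in> topspace ?X. agree E y x}"]) simp
    qed
    then show ?thesis unfolding continuous_map_def by simp
  qed
  then have "continuous_map ?X (product_topology (\<lambda>_. discrete_topology UNIV) (Field \<tau>))
      (\<lambda>x. restrict (\<phi> x) (Field \<tau>))"
    unfolding continuous_map_componentwise by auto
  then show ?thesis by (simp add: cantor_cube_def)
qed

text \<open>
  Points of the cube are extensional functions. To be free to change coordinates, closed sets and
  maps are lifted to the space of all functions by ignoring, respectively keeping, the coordinates
  outside the index set.
\<close>

definition lift_set :: "'i set \<Rightarrow> ('i \<Rightarrow> bool) set \<Rightarrow> ('i \<Rightarrow> bool) set" where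
  "lift_set T P = {x. restrict x T \<in> P}"

definition lift_map :: "'i set \<Rightarrow> (('i \<Rightarrow> bool) \<Rightarrow> ('i \<Rightarrow> bool)) \<Rightarrow> ('i \<Rightarrow> bool) \<Rightarrow> 'i \<Rightarrow> bool" where
  "lift_map T f x = (\<lambda>i. if i \<in> T then f (restrict x T) i else x i)"

lemma agree_restrict: "E \<subseteq> T \<Longrightarrow> agree E x y \<Longrightarrow> agree E (restrict x T) (restrict y T)"
  unfolding agree_def by (metis restrict_apply)

lemma restrict_in_cantor_cube [simp]: "restrict x (Field \<tau>) \<in> topspace (cantor_cube \<tau>)"
  by (simp add: topspace_cantor_cube)

lemma restrict_cantor_cube_id: "x \<in> topspace (cantor_cube \<tau>) \<Longrightarrow> restrict x (Field \<tau>) = x"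
  by (simp add: topspace_cantor_cube extensional_restrict)

section \<open>The topological hypotheses for lifted sets and maps\<close>

lemma cylinder_closed_lift_set:
  assumes "closedin (cantor_cube \<tau>) P"
  shows "cylinder_closed (Field \<tau>) (lift_set (Field \<tau>) P)"
  unfolding cylinder_closed_def
proof (intro allI impI)
  fix x assume "x \<notin> lift_set (Field \<tau>) P"
  then have "restrict x (Field \<tau>) \<in> topspace (cantor_cube \<tau>) - P" by (simp add: lift_set_def)
  moreover have "openin (cantor_cube \<tau>) (topspace (cantor_cube \<tau>) - P)"
    using assms by (simp add: closedin_def)
  ultimately obtain E where E: "finite E" "E \<subseteq> Field \<tau>"
    "\<And>y. y \<in> topspace (cantor_cube \<tau>) \<Longrightarrow> agree E y (restrict x (Field \<tau>)) \<Longrightarrow> y \<notin> P"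
    using cantor_cube_open_cylinder by (metis DiffD2)
  have "y \<notin> lift_set (Field \<tau>) P" if "agree E y x" for y
    using E(3)[OF restrict_in_cantor_cube agree_restrict[OF E(2) that]] by (simp add: lift_set_def)
  then show "\<exists>E. finite E \<and> E \<subseteq> Field \<tau> \<and> (\<forall>y. agree E y x \<longrightarrow> y \<notin> lift_set (Field \<tau>) P)"
    using E(1,2) by (intro exI[of _ E]) simp
qed

text \<open>Each of the at most \<open>\<kappa>\<close> open sets contains a cylinder around the
  point with finite support. The union \<open>D\<close> of the supports still has size at most
  \<open>\<kappa>\<close>, and points that agree on \<open>D\<close> lie in all of these
  sets.\<close>

lemma lift_set_small_cube:
  assumes \<kappa>: "Cinfinite \<kappa>" and int: "mu_interior (cantor_cube \<tau>) \<kappa> P = P"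
    and x: "x \<in> lift_set (Field \<tau>) P"
  shows "\<exists>D\<subseteq>Field \<tau>. |D| \<le>o \<kappa> \<and> (\<forall>y. agree D y x \<longrightarrow> y \<in> lift_set (Field \<tau>) P)"
proof -
  have "restrict x (Field \<tau>) \<in> mu_interior (cantor_cube \<tau>) \<kappa> P"
    using x int by (simp add: lift_set_def)
  then obtain G where G: "G_subset (cantor_cube \<tau>) \<kappa> G" "restrict x (Field \<tau>) \<in> G" "G \<subseteq> P"
    using \<kappa> unfolding mu_interior_def cinfinite_def by auto
  then obtain \<U> where U: "\<forall>U\<in>\<U>. openin (cantor_cube \<tau>) U" "|\<U>| \<le>o \<kappa>"
    "G = topspace (cantor_cube \<tau>) \<inter> \<Inter>\<U>"
    unfolding G_subset_def by auto
  have "\<forall>U\<in>\<U>. \<exists>E. finite E \<and> E \<subseteq> Field \<tau> \<and>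
      (\<forall>y\<in>topspace (cantor_cube \<tau>). agree E y (restrict x (Field \<tau>)) \<longrightarrow> y \<in> U)"
  proof
    fix U assume "U \<in> \<U>"
    then show "\<exists>E. finite E \<and> E \<subseteq> Field \<tau> \<and>
      (\<forall>y\<in>topspace (cantor_cube \<tau>). agree E y (restrict x (Field \<tau>)) \<longrightarrow> y \<in> U)"
      using U(1,3) G(2) by (intro cantor_cube_open_cylinder) auto
  qed
  from bchoice[OF this] obtain E where E: "\<forall>U\<in>\<U>. finite (E U) \<and> E U \<subseteq> Field \<tau> \<and>
      (\<forall>y\<in>topspace (cantor_cube \<tau>). agree (E U) y (restrict x (Field \<tau>)) \<longrightarrow> y \<in> U)" ..
  define D where "D = (\<Union>U\<in>\<U>. E U)"
  have "D \<subseteq> Field \<tau>" using E by (auto simp: D_def)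
  moreover have "|D| \<le>o \<kappa>"
    unfolding D_def using E
    by (intro UNION_Cinfinite_bound \<kappa> U(2) ballI countable_card_le countable_finite) auto
  moreover have "y \<in> lift_set (Field \<tau>) P" if y: "agree D y x" for y
  proof -
    have "restrict y (Field \<tau>) \<in> U" if "U \<in> \<U>" for U
    proof -
      have "agree (E U) y x" using y by (rule agree_mono) (use that in \<open>auto simp: D_def\<close>)
      then have "agree (E U) (restrict y (Field \<tau>)) (restrict x (Field \<tau>))"
        using E that by (intro agree_restrict) auto
      then show ?thesis using E that by auto
    qed
    then show ?thesis using G(3) U(3) by (auto simp: lift_set_def)
  qed
  ultimately show ?thesis by (intro exI[of _ D]) simp
qed

text \<open>Otherwise \<open>P\<close> would contain a whole cube fixing only the coordinates in
  \<open>B\<close>. It is open for finite \<open>B\<close> and an intersection of \<open>|B|\<close>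
  one-coordinate cylinders in general, which contradicts negligibility.\<close>

lemma lift_set_thin:
  fixes \<kappa> :: "'k rel"
  assumes \<kappa>: "Cinfinite \<kappa>" and neg: "negligible_below (cantor_cube \<tau>) \<kappa> P"
    and B: "B \<subseteq> Field \<tau>" "|B| <o \<kappa>"
  shows "\<exists>y. agree B y x \<and> y \<notin> lift_set (Field \<tau>) P"
proof (rule ccontr)
  let ?X = "cantor_cube \<tau>"
  assume "\<not> (\<exists>y. agree B y x \<and> y \<notin> lift_set (Field \<tau>) P)"
  then have cube: "y \<in> P" if "y \<in> topspace ?X" "agree B y x" for y
    using that restrict_cantor_cube_id[OF that(1)] unfolding lift_set_def by auto
  define x0 where "x0 = restrict x (Field \<tau>)"
  have x0: "x0 \<in> topspace ?X" "agree B x0 x"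
    using B(1) by (auto simp: x0_def agree_def)
  have agree_x0: "agree E y x0 \<longleftrightarrow> agree E y x" if "E \<subseteq> B" for E y
    using agree_mono[OF x0(2) that] by (rule agree_cong)
  have "Card_order \<kappa>" using \<kappa> by simp
  then have "|B| \<le>o |Field \<kappa>|"
    using B(2) card_of_Field_ordIso ordIso_symmetric ordLess_imp_ordLeq ordLeq_ordIso_trans by blast
  then obtain h where h: "inj_on h B" "h ` B \<subseteq> Field \<kappa>" using card_of_ordLeq[of B "Field \<kappa>"] by auto
  \<comment> \<open>Negligibility speaks of cardinals on the type of \<open>\<kappa>\<close>, so
    \<open>|B|\<close> is replaced by its copy on a subset of \<open>Field \<kappa>\<close>.\<close>
  define \<mu> where "\<mu> = |h ` B|"
  have \<mu>B: "|B| =o \<mu>"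
    unfolding \<mu>_def using h(1) card_of_ordIso inj_on_imp_bij_betw by blast
  then have "\<mu> <o \<kappa>" using B(2) ordIso_symmetric ordIso_ordLess_trans by blast
  moreover have "Card_order \<mu>" by (simp add: \<mu>_def card_of_Card_order)
  ultimately have empty: "mu_interior ?X \<mu> P = {}"
    using neg unfolding negligible_below_def by blast
  have "x0 \<in> mu_interior ?X \<mu> P"
  proof (cases "finite (Field \<mu>)")
    case True
    then have "finite B" using h(1) by (simp add: \<mu>_def Field_card_of finite_image_iff)
    have "openin ?X {y \<in> topspace ?X. agree B y x}"
      by (rule openin_cantor_cube_cylinder[OF \<open>finite B\<close> B(1)])
    moreover have "{y \<in> topspace ?X. agree B y x} \<subseteq> P" using cube by auto
    ultimately have "x0 \<in> ?X interior_of P" using x0 unfolding interior_of_def by auto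
    then show ?thesis using True by (simp add: mu_interior_def)
  next
    case False
    define \<U> where "\<U> = (\<lambda>i. {y \<in> topspace ?X. agree {i} y x}) ` B"
    have "\<forall>U\<in>\<U>. openin ?X U"
      using B(1) unfolding \<U>_def by (auto intro!: openin_cantor_cube_cylinder)
    moreover have "|\<U>| \<le>o \<mu>"
      using card_of_image \<mu>B ordLeq_ordIso_trans unfolding \<U>_def by blast
    ultimately have "G_subset ?X \<mu> (topspace ?X \<inter> \<Inter>\<U>)" unfolding G_subset_def by blast
    moreover have "x0 \<in> topspace ?X \<inter> \<Inter>\<U>" using x0 by (auto simp: \<U>_def agree_def)
    moreover have "topspace ?X \<inter> \<Inter>\<U> \<subseteq> P"
    proof
      fix y assume y: "y \<in> topspace ?X \<inter> \<Inter>\<U>"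
      then have "agree B y x" by (auto simp: \<U>_def agree_def)
      then show "y \<in> P" using y cube by auto
    qed
    moreover have "x0 \<in> P" using cube x0 by auto
    ultimately show ?thesis using False unfolding mu_interior_def by auto
  qed
  then show False using empty by simp
qed

text \<open>Continuity makes each coordinate of \<open>f\<close> locally constant on
  \<open>P\<close>; since \<open>P\<close> is closed, compactness makes this uniform.\<close>

lemma fin_dep_lift_map:
  assumes closed: "closedin (cantor_cube \<tau>) P"
    and cont: "continuous_map (subtopology (cantor_cube \<tau>) P) (subtopology (cantor_cube \<tau>) K) f"
    and i: "i \<in> Field \<tau>"
  shows "fin_dep (lift_set (Field \<tau>) P) (Field \<tau>) (\<lambda>x. lift_map (Field \<tau>) f x i)"
proof (rule fin_dep_of_local[OF cylinder_closed_lift_set[OF closed]])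
  let ?X = "cantor_cube \<tau>"
  fix x assume x: "x \<in> lift_set (Field \<tau>) P"
  define x0 where "x0 = restrict x (Field \<tau>)"
  have x0: "x0 \<in> P" using x by (simp add: lift_set_def x0_def)
  have PX: "P \<subseteq> topspace ?X" using closed by (rule closedin_subset)
  have "openin ?X {y \<in> topspace ?X. agree {i} y (f x0)}"
    by (rule openin_cantor_cube_cylinder) (use i in auto)
  then have "openin (subtopology ?X P) {z \<in> topspace (subtopology ?X P). f z \<in> {y \<in> topspace ?X. agree {i} y (f x0)}}"
    using cont by (intro openin_continuous_map_preimage[where Y = ?X]) (auto simp: continuous_map_in_subtopology)
  then obtain V where V: "openin ?X V"
    "{z \<in> topspace (subtopology ?X P). f z \<in> {y \<in> topspace ?X. agree {i} y (f x0)}} = V \<inter> P"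
    unfolding openin_subtopology by auto
  have fX: "f z \<in> topspace ?X" if "z \<in> P" for z
    using cont that PX unfolding continuous_map_in_subtopology continuous_map_def by auto
  have "x0 \<in> {z \<in> topspace (subtopology ?X P). f z \<in> {y \<in> topspace ?X. agree {i} y (f x0)}}"
    using x0 PX fX by auto
  then have "x0 \<in> V" unfolding V(2) by simp
  from cantor_cube_open_cylinder[OF V(1) this] obtain E where
    E: "finite E" "E \<subseteq> Field \<tau>" "\<And>y. y \<in> topspace ?X \<Longrightarrow> agree E y x0 \<Longrightarrow> y \<in> V" by auto
  have "lift_map (Field \<tau>) f y i = lift_map (Field \<tau>) f x i"
    if y: "y \<in> lift_set (Field \<tau>) P" "agree E y x" for y
  proof -
    have "restrict y (Field \<tau>) \<in> V"
      using agree_restrict[OF E(2) y(2)] by (intro E(3)) (simp_all add: x0_def)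
    then have "restrict y (Field \<tau>) \<in> V \<inter> P" using y(1) by (simp add: lift_set_def)
    then have "f (restrict y (Field \<tau>)) i = f x0 i" unfolding V(2)[symmetric] by (simp add: agree_def)
    then show ?thesis using i by (simp add: lift_map_def x0_def)
  qed
  then show "\<exists>E. finite E \<and> E \<subseteq> Field \<tau> \<and> (\<forall>y\<in>lift_set (Field \<tau>) P.
      agree E y x \<longrightarrow> lift_map (Field \<tau>) f y i = lift_map (Field \<tau>) f x i)"
    using E(1,2) by (intro exI[of _ E]) simp
qed

lemma lift_map_inverse:
  assumes fK: "\<And>x. x \<in> P \<Longrightarrow> f x \<in> K \<and> g (f x) = x" and K: "K \<subseteq> topspace (cantor_cube \<tau>)"
    and x: "x \<in> lift_set (Field \<tau>) P"
  shows "lift_map (Field \<tau>) f x \<in> lift_set (Field \<tau>) K \<and>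
    lift_map (Field \<tau>) g (lift_map (Field \<tau>) f x) = x"
proof -
  have x': "restrict x (Field \<tau>) \<in> P" using x by (simp add: lift_set_def)
  then have "f (restrict x (Field \<tau>)) \<in> topspace (cantor_cube \<tau>)" using fK K by auto
  then have r: "restrict (lift_map (Field \<tau>) f x) (Field \<tau>) = f (restrict x (Field \<tau>))"
    by (auto simp: topspace_cantor_cube lift_map_def restrict_def extensional_def fun_eq_iff)
  have "lift_map (Field \<tau>) g (lift_map (Field \<tau>) f x) i = x i" for i
    using fK[OF x'] unfolding lift_map_def[of _ g] r by (simp add: lift_map_def)
  then have "lift_map (Field \<tau>) g (lift_map (Field \<tau>) f x) = x" ..
  then show ?thesis using fK[OF x'] r by (simp add: lift_set_def)
qed

theorem theorem4p1:
  fixes \<tau> :: "'i rel" and \<kappa> :: "'k rel"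
    and P K :: "('i \<Rightarrow> bool) set" and f :: "('i \<Rightarrow> bool) \<Rightarrow> ('i \<Rightarrow> bool)"
  assumes "Cinfinite \<tau>" and "Cinfinite \<kappa>" and "\<kappa> \<le>o \<tau>"
    and "closedin (cantor_cube \<tau>) P" and "closedin (cantor_cube \<tau>) K"
    and "negligible_below (cantor_cube \<tau>) \<kappa> P" and "negligible_below (cantor_cube \<tau>) \<kappa> K"
    and "mu_interior (cantor_cube \<tau>) \<kappa> P = P" and "mu_interior (cantor_cube \<tau>) \<kappa> K = K"
    and "homeomorphic_map (subtopology (cantor_cube \<tau>) P) (subtopology (cantor_cube \<tau>) K) f"
  shows "\<exists>F. homeomorphic_map (cantor_cube \<tau>) (cantor_cube \<tau>) F \<and> (\<forall>x\<in>P. F x = f x)"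
proof -
  let ?X = "cantor_cube \<tau>" and ?T = "Field \<tau>"
  let ?P = "lift_set ?T P" and ?K = "lift_set ?T K"
  have PX: "P \<subseteq> topspace ?X" and KX: "K \<subseteq> topspace ?X"
    using assms(4,5) closedin_subset by auto
  obtain g where g: "homeomorphic_maps (subtopology ?X P) (subtopology ?X K) f g"
    using assms(10) unfolding homeomorphic_map_maps by auto
  then have cont: "continuous_map (subtopology ?X P) (subtopology ?X K) f"
      "continuous_map (subtopology ?X K) (subtopology ?X P) g"
    and gf: "\<And>x. x \<in> P \<Longrightarrow> g (f x) = x" and fg: "\<And>y. y \<in> K \<Longrightarrow> f (g y) = y"
    using PX KX unfolding homeomorphic_maps_def by auto
  have fP: "f x \<in> K" if "x \<in> P" for x
    using continuous_map_funspace[OF cont(1)] PX KX that by auto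
  have gK: "g y \<in> P" if "y \<in> K" for y
    using continuous_map_funspace[OF cont(2)] PX KX that by auto
  have "inverse_on ?P ?K (lift_map ?T f) (lift_map ?T g)"
    unfolding inverse_on_def
    using lift_map_inverse[of P f K g \<tau>] lift_map_inverse[of K g P f \<tau>] fP gK gf fg PX KX by simp
  moreover have "infinite ?T" using assms(1) by (simp add: cinfinite_def)
  ultimately have "\<exists>\<phi> \<psi>. partial_ext ?P ?K (lift_map ?T f) (lift_map ?T g) ?T \<phi> \<psi>"
    using assms(2) cylinder_closed_lift_set[OF assms(4)] cylinder_closed_lift_set[OF assms(5)]
      fin_dep_lift_map[OF assms(4) cont(1)] fin_dep_lift_map[OF assms(5) cont(2)]
      lift_set_small_cube[OF assms(2,8)] lift_set_small_cube[OF assms(2,9)]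
      lift_set_thin[OF assms(2,6)] lift_set_thin[OF assms(2,7)]
    by (intro cylinder_closed_extension[where \<kappa> = \<kappa>]) auto
  then obtain \<phi> \<psi> where ext: "partial_ext ?P ?K (lift_map ?T f) (lift_map ?T g) ?T \<phi> \<psi>" by auto
  then have fd: "\<forall>i\<in>?T. fin_dep UNIV ?T (\<lambda>x. \<phi> x i)" "\<forall>i\<in>?T. fin_dep UNIV ?T (\<lambda>x. \<psi> x i)"
    and inv: "\<And>x. agree ?T (\<psi> (\<phi> x)) x" "\<And>x. agree ?T (\<phi> (\<psi> x)) x"
    and \<phi>f: "\<And>x. x \<in> ?P \<Longrightarrow> agree ?T (\<phi> x) (lift_map ?T f x)"
    unfolding partial_ext_def by auto
  have eqI: "restrict x ?T = y" if "agree ?T x y" "y \<in> topspace ?X" for x y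
    using that by (auto simp: agree_def topspace_cantor_cube restrict_def extensional_def fun_eq_iff)
  \<comment> \<open>Values of \<open>\<phi>\<close> and \<open>\<psi>\<close> off the index set are
    arbitrary and get cut off. On the index set both maps depend only on coordinates in it, so this
    does not disturb the inverse relations.\<close>
  have restrict: "agree ?T (restrict z ?T) z" for z by (simp add: agree_def)
  have "homeomorphic_maps ?X ?X (\<lambda>x. restrict (\<phi> x) ?T) (\<lambda>x. restrict (\<psi> x) ?T)"
    unfolding homeomorphic_maps_def
  proof (intro conjI ballI)
    show "continuous_map ?X ?X (\<lambda>x. restrict (\<phi> x) ?T)"
      and "continuous_map ?X ?X (\<lambda>x. restrict (\<psi> x) ?T)"
      by (rule continuous_map_cantor_cube[OF fd(1)], rule continuous_map_cantor_cube[OF fd(2)])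
  next
    fix x assume x: "x \<in> topspace ?X"
    show "restrict (\<psi> (restrict (\<phi> x) ?T)) ?T = x"
      using agree_trans[OF fin_dep_agree[OF fd(2) restrict] inv(1)] x by (rule eqI)
    show "restrict (\<phi> (restrict (\<psi> x) ?T)) ?T = x"
      using agree_trans[OF fin_dep_agree[OF fd(1) restrict] inv(2)] x by (rule eqI)
  qed
  then have "homeomorphic_map ?X ?X (\<lambda>x. restrict (\<phi> x) ?T)"
    unfolding homeomorphic_map_maps by auto
  moreover have "restrict (\<phi> x) ?T = f x" if x: "x \<in> P" for x
  proof (rule eqI)
    have x': "restrict x ?T = x" using x PX restrict_cantor_cube_id by auto
    then have "agree ?T (\<phi> x) (lift_map ?T f x)" using x by (intro \<phi>f) (simp add: lift_set_def)
    then show "agree ?T (\<phi> x) (f x)" by (simp add: agree_def lift_map_def x')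
    show "f x \<in> topspace ?X" using fP[OF x] KX by auto
  qed
  ultimately show ?thesis by (intro exI[of _ "\<lambda>x. restrict (\<phi> x) ?T"]) simp
qed

end
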